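(* Let $G$ be a bipartite graph and $I=I(G)$ be its edge ideal. For all $s\ge 1$, $$\operatorname{reg}(I^s)\le 2s+\operatorname{match}(G)-1.$$
   Context: Let $G$ be a bipartite graph with bipartition $X=\{x_1,\ldots,x_n\}$, $Y=\{y_1,\ldots,y_m\}$ of its vertex set, $\mathbb{K}$ a field, and $R=\mathbb{K}[x_1,\ldots,x_n,y_1,\ldots,y_m]$ with its standard grading. The edge ideal $I(G)\subset R$ is generated by the monomials $x_iy_j$ with $x_i$ adjacent to $y_j$. $\operatorname{match}(G)$ is the maximum cardinality of a matching of $G$, and $\operatorname{reg}$ of a homogeneous ideal of $R$ denotes its Castelnuovo–Mumford regularity as a graded $R$-module. *)

theory Defs
  imports
    "HOL-Library.Poly_Mapping"
    "HOL-Library.Extended_Real"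
    "Jordan_Normal_Form.Matrix"
begin

text \<open>
  The polynomial ring over \<^typ>\<open>'k\<close> whose variables are the elements of the finite type
  \<^typ>\<open>'v\<close>: a monomial is its exponent map, a polynomial a finitely supported family of
  coefficients indexed by monomials.
\<close>

type_synonym ('v, 'k) mpol = "('v \<Rightarrow>\<^sub>0 nat) \<Rightarrow>\<^sub>0 'k"

definition var :: "'v \<Rightarrow> ('v, 'k::comm_ring_1) mpol" where
  "var v = Poly_Mapping.single (Poly_Mapping.single v 1) 1"

definition monom_deg :: "('v::finite \<Rightarrow>\<^sub>0 nat) \<Rightarrow> nat" where
  "monom_deg m = (\<Sum>v\<in>UNIV. Poly_Mapping.lookup m v)"

text \<open>Degrees are integers, so that the zero polynomial is the only form of negative degree.\<close>

definition homogeneous :: "int \<Rightarrow> ('v::finite, 'k::comm_ring_1) mpol \<Rightarrow> bool" where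
  "homogeneous d p \<longleftrightarrow> (\<forall>m\<in>Poly_Mapping.keys p. int (monom_deg m) = d)"

definition irrelevant_ideal :: "('v, 'k::comm_ring_1) mpol set" where
  "irrelevant_ideal = {p. Poly_Mapping.lookup p 0 = 0}"

text \<open>An ideal is a submodule of the ring regarded as a module over itself.\<close>

abbreviation ideal_gen :: "'a::comm_ring_1 set \<Rightarrow> 'a set" where
  "ideal_gen S \<equiv> Modules.module.span (*) S"

primrec ideal_power :: "'a::comm_ring_1 set \<Rightarrow> nat \<Rightarrow> 'a set" where
  "ideal_power I 0 = UNIV"
| "ideal_power I (Suc s) = ideal_gen {a * b | a b. a \<in> I \<and> b \<in> ideal_power I s}"

text \<open>
  A graded free resolution of a homogeneous ideal \<^term>\<open>I\<close> of the polynomial ring \<open>R\<close>,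
  \<open>\<dots> \<rightarrow> F\<^sub>2 \<rightarrow> F\<^sub>1 \<rightarrow> F\<^sub>0 \<rightarrow> I \<rightarrow> 0\<close>, is given in coordinates.
  The list \<open>D i = [d\<^sub>1, \<dots>, d\<^sub>r]\<close> holds the degrees of the basis elements of
  \<open>F\<^sub>i = R(-d\<^sub>1) \<oplus> \<dots> \<oplus> R(-d\<^sub>r)\<close>; the empty list stands for the zero module.
  The augmentation \<open>F\<^sub>0 \<rightarrow> I\<close> sends the basis to the entries of the vector \<open>g\<close>, and
  \<open>A i\<close> is the matrix of \<open>F\<^bsub>i+1\<^esub> \<rightarrow> F\<^sub>i\<close>. A homomorphism is graded (of degree 0) iff the
  entry from a basis element of degree \<open>d\<close> to one of degree \<open>e\<close> is homogeneous of degree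
  \<open>d - e\<close>. A finite resolution is one where the \<open>D i\<close> are eventually empty.
\<close>

definition graded_free_resolution ::
  "('v::finite, 'k::field) mpol set \<Rightarrow> (nat \<Rightarrow> int list) \<Rightarrow> ('v, 'k) mpol vec
    \<Rightarrow> (nat \<Rightarrow> ('v, 'k) mpol mat) \<Rightarrow> bool" where
  "graded_free_resolution I D g A \<longleftrightarrow>
     g \<in> carrier_vec (length (D 0)) \<and>
     (\<forall>i. A i \<in> carrier_mat (length (D i)) (length (D (Suc i)))) \<and>
     (\<forall>c<length (D 0). homogeneous (D 0 ! c) (g $ c)) \<and>
     (\<forall>i. \<forall>r<length (D i). \<forall>c<length (D (Suc i)).
        homogeneous (D (Suc i) ! c - D i ! r) (A i $$ (r, c))) \<and>
     {g \<bullet> v | v. v \<in> carrier_vec (length (D 0))} = I \<and>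
     {v \<in> carrier_vec (length (D 0)). g \<bullet> v = 0} =
       {A 0 *\<^sub>v w | w. w \<in> carrier_vec (length (D 1))} \<and>
     (\<forall>i. {v \<in> carrier_vec (length (D (Suc i))). A i *\<^sub>v v = 0\<^sub>v (length (D i))} =
       {A (Suc i) *\<^sub>v w | w. w \<in> carrier_vec (length (D (Suc (Suc i))))})"

text \<open>Minimality: the image of \<open>F\<^bsub>i+1\<^esub>\<close> lies in \<open>\<mm> F\<^sub>i\<close>, \<open>\<mm>\<close> the irrelevant ideal.\<close>

definition minimal_graded_free_resolution ::
  "('v::finite, 'k::field) mpol set \<Rightarrow> (nat \<Rightarrow> int list) \<Rightarrow> ('v, 'k) mpol vec
    \<Rightarrow> (nat \<Rightarrow> ('v, 'k) mpol mat) \<Rightarrow> bool" where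
  "minimal_graded_free_resolution I D g A \<longleftrightarrow>
     graded_free_resolution I D g A \<and>
     (\<forall>i. \<forall>r<length (D i). \<forall>c<length (D (Suc i)). A i $$ (r, c) \<in> irrelevant_ideal)"

text \<open>
  \<open>reg I = max {j - i | \<beta>\<^bsub>i,j\<^esub>(I) \<noteq> 0}\<close>, where the graded Betti number \<open>\<beta>\<^bsub>i,j\<^esub>\<close> is the number
  of basis elements of degree \<open>j\<close> in the \<open>i\<close>-th module of the minimal graded free resolution.
  That resolution exists for every homogeneous ideal and is unique up to isomorphism, so
  ranging over all of them below does not change the set. The supremum is taken in the
  extended reals, which gives the convention \<open>reg 0 = -\<infinity>\<close>.
\<close>

definition reg :: "('v::finite, 'k::field) mpol set \<Rightarrow> ereal" where
  "reg I = Sup {ereal (of_int (j - int i)) | i j.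
     \<exists>D g A. minimal_graded_free_resolution I D g A \<and> j \<in> set (D i)}"

text \<open>
  A simple graph on the vertex set \<^term>\<open>UNIV :: 'v set\<close> is given by its set of edges, an edge
  being the two-element set of its end points.
\<close>

definition bipartition :: "'v set set \<Rightarrow> 'v set \<Rightarrow> 'v set \<Rightarrow> bool" where
  "bipartition E X Y \<longleftrightarrow>
     X \<union> Y = UNIV \<and> X \<inter> Y = {} \<and> (\<forall>e\<in>E. \<exists>x\<in>X. \<exists>y\<in>Y. e = {x, y})"

definition edge_ideal :: "'v set set \<Rightarrow> ('v, 'k::comm_ring_1) mpol set" where
  "edge_ideal E = ideal_gen {var u * var v | u v. {u, v} \<in> E}"

definition matching :: "'v set set \<Rightarrow> 'v set set \<Rightarrow> bool" where
  "matching E M \<longleftrightarrow> M \<subseteq> E \<and> pairwise disjnt M"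

definition matching_number :: "'v::finite set set \<Rightarrow> nat" where
  "matching_number E = Max (card ` {M. matching E M})"

end

theory Submission
  imports Defs "HOL-Library.Sublist" "HOL-Library.Function_Algebras"
begin

text \<open>
Let \<open>R\<close> be the polynomial ring and write \<open>a(C)\<close> for the sum of an exponent vector \<open>a\<close> over a set \<open>C\<close>
of vertices. Since \<open>G\<close> is bipartite, a max-flow min-cut argument shows that a monomial \<open>x\<^sup>a\<close> lies in
\<open>I\<^sup>s\<close> iff \<open>a(C) \<ge> s\<close> for every vertex cover \<open>C\<close> (\<open>power_exponents_iff_cover\<close>); minimal covers
suffice. Hence the monomials outside \<open>I\<^sup>s\<close> are the union of the sets \<open>B\<^sub>C = {a. a(C) < s}\<close> over
the minimal covers \<open>C\<close>; in other words, \<open>I\<^sup>s\<close> is the intersection of the powers \<open>P\<^sub>C\<^sup>s\<close> of the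
primes \<open>P\<^sub>C\<close> generated by the variables in \<open>C\<close>.

The minimal covers form a poset, ordered by their part in \<open>X\<close>. The weights of the join and the
meet of two covers add up to at most the weights of the two covers, so a cover \<open>C\<^sub>0\<close> of least weight
has the property that with \<open>C\<close> also the join of \<open>C\<close> and \<open>C\<^sub>0\<close> belongs to
\<open>F\<^sub>a = {C. a(C) < s}\<close>. The comparisons \<open>C \<le> C \<squnion> C\<^sub>0 \<ge> C\<^sub>0\<close> contract the order complex of every nonempty
\<open>F\<^sub>a\<close> (\<open>delta_exact\<close>), and therefore
\<open>0 \<rightarrow> R/I\<^sup>s \<rightarrow> \<Oplus>\<^bsub>C\<^esub> R/P\<^sub>C\<^sup>s \<rightarrow> \<Oplus>\<^bsub>C < C'\<^esub> R/(P\<^sub>C\<^sup>s + P\<^bsub>C'\<^esub>\<^sup>s) \<rightarrow> \<dots>\<close>, summed over chains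
of minimal covers, is exact.

Two numbers now give the bound. First, all covers of a chain lie in the union of its least and its
greatest member, so modulo the sum of the \<open>P\<^sub>C\<^sup>s\<close> over a chain a monomial in the variables of that
union has degree at most \<open>2(s - 1)\<close>, while the other variables are free; such a quotient has regularity
at most \<open>2s - 2\<close> (\<open>acyclic_at_light_chain\<close>). Secondly, a chain \<open>C\<^sub>0 < \<dots> < C\<^sub>t\<close> yields a matching of size
\<open>t\<close>: choose \<open>x\<^sub>i\<close> in the part of \<open>C\<^sub>i\<close> in \<open>X\<close> but not in \<open>C\<^bsub>i-1\<^esub>\<close>, and by minimality of \<open>C\<^sub>i\<close> an edge \<open>x\<^sub>iy\<^sub>i\<close>
covered only by \<open>x\<^sub>i\<close> (\<open>cover_parts_chain_matching\<close>). So the complex has length at most the matching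
number \<open>\<nu>\<close>, each step costs one degree, and \<open>reg (R/I\<^sup>s) \<le> 2s - 2 + \<nu>\<close>,
which is the bound for \<open>I\<^sup>s\<close> shifted by one.

Regularity is measured by Koszul homology. All ideals involved are monomial, so their Koszul complexes
split into multidegrees and become complexes of scalars indexed by sets of variables. The same diagram
chase (\<open>staircase\<close>) is used twice: to pass from the terms of the complex above to \<open>R/I\<^sup>s\<close>
(\<open>acyclic_at_Union\<close>), and to pass from Koszul homology to the degrees in a minimal free resolution
(\<open>koszul_acyclic_imp_no_generator\<close>).
\<close>

section \<open>A diagram chase\<close>

text \<open>
The two differentials \<open>d\<close> (rows) and \<open>e\<close> (columns) of a double complex both lower an index. If the
rows are exact and the columns are exact along one staircase, then an element \<open>z0\<close> whose image under
\<open>d\<close> is an \<open>e\<close>-boundary is homologous to zero: one lifts the image along \<open>e\<close>, pushes it on by \<open>d\<close>, and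
continues down to level \<open>0\<close>, where the rows end; the corrections are then carried back up. At level \<open>0\<close>
exactness of the rows means that \<open>d\<close> is onto.
\<close>

lemma staircase:
  fixes A :: "nat \<Rightarrow> nat \<Rightarrow> 'g::ab_group_add set" and d e :: "nat \<Rightarrow> 'g \<Rightarrow> 'g"
  assumes diff: "\<And>l q x y. x \<in> A l q \<Longrightarrow> y \<in> A l q \<Longrightarrow> x - y \<in> A l q"
    and zero: "\<And>l q. 0 \<in> A l q"
    and d_in: "\<And>l q x. x \<in> A (Suc l) q \<Longrightarrow> d l x \<in> A l q"
    and e_in: "\<And>l q x. x \<in> A l (Suc q) \<Longrightarrow> e l x \<in> A l q"
    and d_diff: "\<And>l x y. d l (x - y) = d l x - d l y"
    and e_diff: "\<And>l x y. e l (x - y) = e l x - e l y"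
    and comm: "\<And>l q x. x \<in> A (Suc l) (Suc q) \<Longrightarrow> d l (e (Suc l) x) = e l (d l x)"
    and dd: "\<And>l q x. x \<in> A (Suc (Suc l)) q \<Longrightarrow> d l (d (Suc l) x) = 0"
    and ee: "\<And>l q x. x \<in> A l (Suc (Suc q)) \<Longrightarrow> e l (e l x) = 0"
    and surj: "\<And>q z. z \<in> A 0 q \<Longrightarrow> \<exists>y\<in>A 1 q. d 0 y = z"
    and d_exact: "\<And>l q z. z \<in> A (Suc l) q \<Longrightarrow> d l z = 0 \<Longrightarrow> \<exists>y\<in>A (Suc (Suc l)) q. d (Suc l) y = z"
    and e_exact: "\<And>l q z. Suc (Suc l) \<le> l0 \<Longrightarrow> Suc l + Suc q = l0 + q0 \<Longrightarrow> z \<in> A l (Suc q)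
        \<Longrightarrow> e l z = 0 \<Longrightarrow> \<exists>y\<in>A l (Suc (Suc q)). e l y = z"
    and start: "z0 \<in> A l0 q0" "\<And>l. l0 = Suc l \<Longrightarrow> \<exists>z'\<in>A l (Suc q0). d l z0 = e l z'"
  shows "\<exists>y\<in>A (Suc l0) q0. \<exists>w\<in>A l0 (Suc q0). z0 = d l0 y + e l0 w"
proof -
  have "\<exists>y\<in>A (Suc l) q. \<exists>w\<in>A l (Suc q). z = d l y + e l w"
    if "l \<le> l0" "l + q = l0 + q0" "z \<in> A l q" "\<And>l'. l = Suc l' \<Longrightarrow> \<exists>z'\<in>A l' (Suc q). d l' z = e l' z'"
    for l q z
    using that
  proof (induction l arbitrary: q z)
    case 0
    obtain y where "y \<in> A 1 q" "d 0 y = z" using surj 0 by blast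
    moreover have "e 0 0 = 0" using e_diff[of 0 0 0] by simp
    ultimately show ?case using zero[of 0 "Suc q"] by (metis One_nat_def add.right_neutral)
  next
    case (Suc l)
    obtain z' where z': "z' \<in> A l (Suc q)" "d l z = e l z'" using Suc.prems by blast
    have "\<exists>z''\<in>A l' (Suc (Suc q)). d l' z' = e l' z''" if l': "l = Suc l'" for l'
    proof -
      have "e l' (d l' z') = d l' (e l z')" using comm z' l' by metis
      also have "\<dots> = 0" using z' dd Suc.prems(3) l' by metis
      finally have "e l' (d l' z') = 0" .
      moreover have "d l' z' \<in> A l' (Suc q)" using d_in z' l' by blast
      moreover have "Suc (Suc l') \<le> l0" "Suc l' + Suc q = l0 + q0" using Suc.prems(1,2) l' by simp_all
      ultimately have "\<exists>y\<in>A l' (Suc (Suc q)). e l' y = d l' z'" by (intro e_exact)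
      then show ?thesis by metis
    qed
    then obtain y' w' where y': "y' \<in> A (Suc l) (Suc q)" "w' \<in> A l (Suc (Suc q))" "z' = d l y' + e l w'"
      using Suc.IH[of "Suc q" z'] Suc.prems(1,2) z'(1) by (metis Suc_leD add_Suc add_Suc_right)
    have "e l z' - e l (d l y') = e l (e l w')" using y'(3) e_diff[of l z' "d l y'"] by simp
    then have "e l z' = e l (d l y')" using ee y'(2) by simp
    then have "d l (z - e (Suc l) y') = 0" using comm[OF y'(1)] z'(2) d_diff by simp
    moreover have "z - e (Suc l) y' \<in> A (Suc l) q" using diff Suc.prems(3) e_in[OF y'(1)] by blast
    ultimately obtain y where "y \<in> A (Suc (Suc l)) q" "d (Suc l) y = z - e (Suc l) y'"
      using d_exact by blast
    then show ?case using y'(1) by (metis diff_add_cancel)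
  qed
  then show ?thesis using start by blast
qed

section \<open>Koszul complexes\<close>

definition ksgn :: "'v::finite \<Rightarrow> 'v set \<Rightarrow> 'a::comm_ring_1" where
  "ksgn v \<sigma> = (-1) ^ card {u \<in> \<sigma>. to_nat u < to_nat v}"

lemma ksgn_sq [simp]: "ksgn v \<sigma> * ksgn v \<sigma> = (1::'a::comm_ring_1)"
  by (simp add: ksgn_def flip: power_add mult_2)

lemma ksgn_insert:
  assumes "u \<notin> \<sigma>"
  shows "ksgn v (insert u \<sigma>) = (if to_nat u < to_nat v then - ksgn v \<sigma> else (ksgn v \<sigma> :: 'a::comm_ring_1))"
proof -
  have "{w \<in> insert u \<sigma>. to_nat w < to_nat v} =
      (if to_nat u < to_nat v then insert u {w \<in> \<sigma>. to_nat w < to_nat v} else {w \<in> \<sigma>. to_nat w < to_nat v})"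
    by auto
  then show ?thesis using assms by (auto simp: ksgn_def)
qed

lemma ksgn_swap:
  assumes "u \<notin> \<sigma>" "v \<notin> \<sigma>" "u \<noteq> v"
  shows "ksgn v \<sigma> * ksgn u (insert v \<sigma>) = - (ksgn u \<sigma> * ksgn v (insert u \<sigma>) :: 'a::comm_ring_1)"
proof -
  have "to_nat u \<noteq> to_nat v" using assms by (metis from_nat_to_nat)
  then show ?thesis using assms by (auto simp: ksgn_insert)
qed

text \<open>
The terms cancel in pairs. That the sum equals its own negative would not suffice in characteristic two.
\<close>

lemma alternating_double_sum_eq_0:
  fixes F :: "'v::finite \<Rightarrow> 'v \<Rightarrow> 'a::ab_group_add"
  assumes "\<And>u v. u \<in> S \<Longrightarrow> v \<in> S \<Longrightarrow> u \<noteq> v \<Longrightarrow> F u v = - F v u"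
  shows "(\<Sum>v\<in>S. \<Sum>u\<in>S - {v}. F v u) = 0"
proof -
  let ?lt = "{(v,u). v \<in> S \<and> u \<in> S \<and> to_nat v < to_nat u}"
  let ?gt = "{(v,u). v \<in> S \<and> u \<in> S \<and> to_nat u < to_nat v}"
  have "(\<Sum>v\<in>S. \<Sum>u\<in>S - {v}. F v u) = (\<Sum>(v,u)\<in>(SIGMA v:S. S - {v}). F v u)"
    by (subst sum.Sigma) auto
  also have "(SIGMA v:S. S - {v}) = ?lt \<union> ?gt"
  proof -
    have "to_nat u \<noteq> to_nat v" if "u \<noteq> v" for u v :: 'v
      using that by (metis from_nat_to_nat)
    then show ?thesis by (fastforce simp: nat_neq_iff)
  qed
  also have "(\<Sum>(v,u)\<in>?lt \<union> ?gt. F v u) = (\<Sum>(v,u)\<in>?lt. F v u) + (\<Sum>(v,u)\<in>?gt. F v u)"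
    by (rule sum.union_disjoint) auto
  also have "(\<Sum>(v,u)\<in>?gt. F v u) = (\<Sum>(v,u)\<in>?lt. F u v)"
    by (rule sum.reindex_bij_witness[of _ prod.swap prod.swap]) auto
  also have "(\<Sum>(v,u)\<in>?lt. F u v) = (\<Sum>(v,u)\<in>?lt. - F v u)"
    by (rule sum.cong) (auto intro: assms)
  also have "(\<Sum>(v,u)\<in>?lt. F v u) + \<dots> = 0" by (simp add: sum_negf case_prod_unfold)
  finally show ?thesis .
qed

text \<open>
The Koszul differential of the sequence \<open>x\<close>. A chain assigns a coefficient to each set of indices; the
total order needed for the signs is the one given by \<^const>\<open>to_nat\<close>.
\<close>

definition kbd :: "('v::finite \<Rightarrow> 'a::comm_ring_1) \<Rightarrow> ('v set \<Rightarrow> 'a) \<Rightarrow> 'v set \<Rightarrow> 'a" where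
  "kbd x c \<tau> = (\<Sum>v\<in>-\<tau>. ksgn v \<tau> * x v * c (insert v \<tau>))"

lemma kbd_kbd: "kbd x (kbd x c) \<tau> = 0"
proof -
  let ?F = "\<lambda>v u. ksgn v \<tau> * ksgn u (insert v \<tau>) * (x v * x u * c (insert u (insert v \<tau>)))"
  have "kbd x (kbd x c) \<tau> = (\<Sum>v\<in>-\<tau>. \<Sum>u\<in>-\<tau> - {v}. ?F v u)"
    unfolding kbd_def sum_distrib_left
    by (intro sum.cong) (auto simp: algebra_simps)
  also have "\<dots> = 0"
  proof (rule alternating_double_sum_eq_0)
    fix u v assume "u \<in> -\<tau>" "v \<in> -\<tau>" "u \<noteq> v"
    then have "ksgn v \<tau> * ksgn u (insert v \<tau>) = - (ksgn u \<tau> * ksgn v (insert u \<tau>) :: 'a)"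
      by (intro ksgn_swap) auto
    then show "?F u v = - ?F v u"
      by (simp add: insert_commute algebra_simps)
  qed
  finally show ?thesis .
qed

lemma kbd_diff: "kbd x (c - c') \<tau> = kbd x c \<tau> - kbd x c' \<tau>"
  by (simp add: kbd_def sum_subtractf right_diff_distrib)

lemma kbd_cong_insert: "(\<And>v. v \<notin> \<tau> \<Longrightarrow> c (insert v \<tau>) = c' (insert v \<tau>)) \<Longrightarrow> kbd x c \<tau> = kbd x c' \<tau>"
  by (simp add: kbd_def)

text \<open>
The exponent of \<open>x\<^sup>\<alpha>\<close> divided by the product of the variables in \<open>\<sigma>\<close>; it is only meaningful where
\<open>\<alpha>\<close> is positive on \<open>\<sigma>\<close>.
\<close>

definition esub :: "('v \<Rightarrow> nat) \<Rightarrow> 'v set \<Rightarrow> 'v \<Rightarrow> nat" where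
  "esub \<alpha> \<sigma> v = (if v \<in> \<sigma> then \<alpha> v - 1 else \<alpha> v)"

lemma esub_empty [simp]: "esub \<alpha> {} = \<alpha>"
  by (auto simp: esub_def)

lemma esub_mono: "\<tau> \<subseteq> \<sigma> \<Longrightarrow> esub \<alpha> \<sigma> \<le> esub \<alpha> \<tau>"
  by (auto simp: esub_def le_fun_def)

definition downset :: "'a::order set \<Rightarrow> bool" where
  "downset B \<longleftrightarrow> (\<forall>a b. a \<le> b \<longrightarrow> b \<in> B \<longrightarrow> a \<in> B)"

lemma downsetD: "downset B \<Longrightarrow> b \<in> B \<Longrightarrow> a \<le> b \<Longrightarrow> a \<in> B"
  unfolding downset_def by iprover

text \<open>
For a down-closed set \<open>B\<close> of exponents, the monomials outside \<open>B\<close> span an ideal \<open>J\<close>. In multidegree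
\<open>\<alpha>\<close>, the Koszul complex of \<open>R/J\<close> has a basis of the sets \<open>\<sigma>\<close> with \<open>x\<^sup>\<alpha> / x\<^sup>\<sigma>\<close> a monomial in \<open>B\<close>. Its
differential forgets the sets \<open>\<tau>\<close> for which this monomial lies in \<open>J\<close>, since there it is zero in \<open>R/J\<close>.
\<close>

definition koszul :: "('v::finite \<Rightarrow> nat) set \<Rightarrow> ('v \<Rightarrow> nat) \<Rightarrow> nat \<Rightarrow> ('v set \<Rightarrow> 'k::comm_ring_1) set" where
  "koszul B \<alpha> p = {c. \<forall>\<sigma>. c \<sigma> \<noteq> 0 \<longrightarrow> card \<sigma> = p \<and> (\<forall>v\<in>\<sigma>. 0 < \<alpha> v) \<and> esub \<alpha> \<sigma> \<in> B}"

definition kbd_on :: "('v::finite \<Rightarrow> nat) set \<Rightarrow> ('v \<Rightarrow> nat) \<Rightarrow> ('v set \<Rightarrow> 'k::comm_ring_1) \<Rightarrow> 'v set \<Rightarrow> 'k" where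
  "kbd_on B \<alpha> c \<tau> = (if esub \<alpha> \<tau> \<in> B then kbd (\<lambda>_. 1) c \<tau> else 0)"

text \<open>
The type argument names the ring of coefficients, which \<open>B\<close>, \<open>\<alpha>\<close> and \<open>p\<close> do not determine.
\<close>

definition acyclic_at :: "'k::comm_ring_1 itself \<Rightarrow> ('v::finite \<Rightarrow> nat) set \<Rightarrow> ('v \<Rightarrow> nat) \<Rightarrow> nat \<Rightarrow> bool" where
  "acyclic_at _ B \<alpha> p \<longleftrightarrow>
     (\<forall>c\<in>koszul B \<alpha> p. kbd_on B \<alpha> c = 0 \<longrightarrow> (\<exists>b\<in>koszul B \<alpha> (Suc p). kbd_on B \<alpha> b = (c :: 'v set \<Rightarrow> 'k)))"

lemma koszul_diff: "c \<in> koszul B \<alpha> p \<Longrightarrow> c' \<in> koszul B \<alpha> p \<Longrightarrow> c - c' \<in> koszul B \<alpha> p"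
  unfolding koszul_def by (simp) (metis diff_0_right diff_zero right_minus_eq)

lemma koszul_zero [simp]: "0 \<in> koszul B \<alpha> p"
  by (simp add: koszul_def)

lemma kbd_on_diff: "kbd_on B \<alpha> (c - c') = kbd_on B \<alpha> c - kbd_on B \<alpha> c'"
  by (rule ext) (simp add: kbd_on_def kbd_diff)

lemma kbd_on_zero [simp]: "kbd_on B \<alpha> 0 = 0"
  by (rule ext) (simp add: kbd_on_def kbd_def)

lemma kbd_nonzeroE:
  assumes "kbd x c \<tau> \<noteq> 0" obtains v where "v \<notin> \<tau>" "c (insert v \<tau>) \<noteq> 0"
proof -
  have "\<exists>v. v \<notin> \<tau> \<and> c (insert v \<tau>) \<noteq> 0"
  proof (rule ccontr)
    assume "\<not> ?thesis"
    then have "kbd x c \<tau> = 0" unfolding kbd_def by (intro sum.neutral) auto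
    with assms show False by contradiction
  qed
  then show ?thesis using that by blast
qed

lemma kbd_on_in:
  assumes "c \<in> koszul B \<alpha> (Suc p)" shows "kbd_on B \<alpha> c \<in> koszul B \<alpha> p"
proof -
  have "card \<tau> = p \<and> (\<forall>v\<in>\<tau>. 0 < \<alpha> v) \<and> esub \<alpha> \<tau> \<in> B" if "kbd_on B \<alpha> c \<tau> \<noteq> 0" for \<tau>
  proof -
    have B: "esub \<alpha> \<tau> \<in> B" "kbd (\<lambda>_. 1) c \<tau> \<noteq> 0" using that by (auto simp: kbd_on_def split: if_splits)
    then obtain v where "v \<notin> \<tau>" "c (insert v \<tau>) \<noteq> 0" by (blast elim: kbd_nonzeroE)
    then show ?thesis using assms B by (fastforce simp: koszul_def)
  qed
  then show ?thesis by (simp add: koszul_def)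
qed

lemma kbd_kbd_on:
  assumes "downset B" "esub \<alpha> \<tau> \<in> B"
  shows "kbd x (kbd_on B \<alpha> c) \<tau> = kbd x (kbd (\<lambda>_. 1) c) \<tau>"
proof (rule kbd_cong_insert)
  fix v
  have "esub \<alpha> (insert v \<tau>) \<in> B"
    using assms by (rule downsetD) (auto intro: esub_mono)
  then show "kbd_on B \<alpha> c (insert v \<tau>) = kbd (\<lambda>_. 1) c (insert v \<tau>)"
    by (simp add: kbd_on_def)
qed

lemma kbd_on_kbd_on: "downset B \<Longrightarrow> kbd_on B \<alpha> (kbd_on B \<alpha> c) = 0"
  by (rule ext) (simp add: kbd_on_def[of B \<alpha> "kbd_on B \<alpha> c"] kbd_kbd_on kbd_kbd)

text \<open>
Inserting \<open>v0\<close> into every set is a contraction. Inserting \<open>v0\<close> before or after another element gives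
opposite signs, so in the boundary everything cancels except \<open>c \<tau>\<close>.
\<close>

lemma kbd_cone:
  fixes c :: "'v::finite set \<Rightarrow> 'k::comm_ring_1"
  assumes cyc: "v0 \<in> \<tau> \<Longrightarrow> kbd (\<lambda>_. 1) c (\<tau> - {v0}) = 0"
  defines "b \<equiv> \<lambda>\<sigma>. if v0 \<in> \<sigma> then ksgn v0 (\<sigma> - {v0}) * c (\<sigma> - {v0}) else 0"
  shows "kbd (\<lambda>_. 1) b \<tau> = c \<tau>"
proof (cases "v0 \<in> \<tau>")
  case False
  have "kbd (\<lambda>_. 1) b \<tau> = (\<Sum>v\<in>{v0}. ksgn v \<tau> * 1 * b (insert v \<tau>))"
    unfolding kbd_def using False by (intro sum.mono_neutral_right) (auto simp: b_def)
  also have "\<dots> = c \<tau>" using False by (simp add: b_def flip: mult.assoc)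
  finally show ?thesis .
next
  case True
  define \<rho> where "\<rho> = \<tau> - {v0}"
  have \<tau>: "\<tau> = insert v0 \<rho>" "v0 \<notin> \<rho>" using True by (auto simp: \<rho>_def)
  have "ksgn v \<tau> * b (insert v \<tau>) = - (ksgn v0 \<rho> * (ksgn v \<rho> * c (insert v \<rho>)))" if "v \<notin> \<tau>" for v
  proof -
    have "insert v \<tau> - {v0} = insert v \<rho>" using that \<tau> by auto
    moreover have "ksgn v0 \<rho> * ksgn v \<tau> = - (ksgn v \<rho> * ksgn v0 (insert v \<rho>) :: 'k)"
      unfolding \<tau> by (rule ksgn_swap) (use that \<tau> in auto)
    ultimately have "ksgn v \<tau> * b (insert v \<tau>) = ksgn v0 \<rho> * ksgn v0 \<rho> * ksgn v \<tau> * ksgn v0 (insert v \<rho>) * c (insert v \<rho>)"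
      using True by (simp add: b_def)
    also have "\<dots> = ksgn v0 \<rho> * (ksgn v0 \<rho> * ksgn v \<tau>) * ksgn v0 (insert v \<rho>) * c (insert v \<rho>)"
      by (simp only: mult.assoc)
    also have "\<dots> = - (ksgn v0 \<rho> * ksgn v \<rho> * (ksgn v0 (insert v \<rho>) * ksgn v0 (insert v \<rho>)) * c (insert v \<rho>))"
      unfolding \<open>ksgn v0 \<rho> * ksgn v \<tau> = _\<close> by (simp only: mult_minus_left mult_minus_right mult.assoc)
    finally show ?thesis by (simp add: mult.assoc)
  qed
  then have "kbd (\<lambda>_. 1) b \<tau> = (\<Sum>v\<in>-\<tau>. - (ksgn v0 \<rho> * (ksgn v \<rho> * c (insert v \<rho>))))"
    unfolding kbd_def by (intro sum.cong) auto
  also have "\<dots> = - (ksgn v0 \<rho> * (\<Sum>v\<in>-\<tau>. ksgn v \<rho> * c (insert v \<rho>)))"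
    by (simp add: sum_negf sum_distrib_left)
  also have "(\<Sum>v\<in>-\<tau>. ksgn v \<rho> * c (insert v \<rho>)) = kbd (\<lambda>_. 1) c \<rho> - ksgn v0 \<rho> * c \<tau>"
  proof -
    have "-\<rho> = insert v0 (-\<tau>)" using \<tau> by auto
    then show ?thesis using \<tau> by (simp add: kbd_def)
  qed
  also have "kbd (\<lambda>_. 1) c \<rho> = 0" using cyc True by (simp add: \<rho>_def)
  finally show ?thesis by (simp flip: mult.assoc)
qed

text \<open>
A free variable that occurs in the multidegree kills all homology, because multiplication by it does
not change membership in \<open>B\<close>.
\<close>

lemma acyclic_at_cone:
  fixes B :: "('v::finite \<Rightarrow> nat) set"
  assumes inv: "\<And>a t. a \<in> B \<Longrightarrow> a(v0 := t) \<in> B" and "0 < \<alpha> v0"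
  shows "acyclic_at TYPE('k::comm_ring_1) B \<alpha> p"
  unfolding acyclic_at_def
proof (intro ballI impI)
  fix c :: "'v set \<Rightarrow> 'k"
  assume c: "c \<in> koszul B \<alpha> p" and cyc: "kbd_on B \<alpha> c = 0"
  define b where "b = (\<lambda>\<sigma>. if v0 \<in> \<sigma> then ksgn v0 (\<sigma> - {v0}) * c (\<sigma> - {v0}) else 0)"
  have eq: "esub \<alpha> \<sigma> \<in> B \<longleftrightarrow> esub \<alpha> (\<sigma> - {v0}) \<in> B" if "v0 \<in> \<sigma>" for \<sigma>
  proof -
    have "esub \<alpha> \<sigma> = (esub \<alpha> (\<sigma> - {v0}))(v0 := \<alpha> v0 - 1)" "esub \<alpha> (\<sigma> - {v0}) = (esub \<alpha> \<sigma>)(v0 := \<alpha> v0)"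
      using that by (auto simp: esub_def fun_eq_iff)
    then show ?thesis using inv by metis
  qed
  have "b \<in> koszul B \<alpha> (Suc p)"
  proof -
    have "card \<sigma> = Suc p \<and> (\<forall>v\<in>\<sigma>. 0 < \<alpha> v) \<and> esub \<alpha> \<sigma> \<in> B" if "b \<sigma> \<noteq> 0" for \<sigma>
    proof -
      have *: "v0 \<in> \<sigma>" "c (\<sigma> - {v0}) \<noteq> 0" using that by (auto simp: b_def split: if_splits)
      then have "card (\<sigma> - {v0}) = p \<and> (\<forall>v\<in>\<sigma> - {v0}. 0 < \<alpha> v) \<and> esub \<alpha> (\<sigma> - {v0}) \<in> B"
        using c by (simp add: koszul_def)
      moreover have "card \<sigma> = Suc (card (\<sigma> - {v0}))" using *(1) by (metis card_Suc_Diff1 finite)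
      ultimately show ?thesis using eq[OF *(1)] \<open>0 < \<alpha> v0\<close> by (metis DiffI singletonD)
    qed
    then show ?thesis by (simp add: koszul_def)
  qed
  moreover have "kbd_on B \<alpha> b = c"
  proof
    fix \<tau>
    have "kbd (\<lambda>_. 1) b \<tau> = c \<tau>" if "esub \<alpha> \<tau> \<in> B"
      unfolding b_def
    proof (rule kbd_cone)
      assume "v0 \<in> \<tau>"
      then have "esub \<alpha> (\<tau> - {v0}) \<in> B" using that eq by blast
      then show "kbd (\<lambda>_. 1) c (\<tau> - {v0}) = 0" using fun_cong[OF cyc, of "\<tau> - {v0}"] by (simp add: kbd_on_def)
    qed
    moreover have "c \<tau> = 0" if "esub \<alpha> \<tau> \<notin> B" using c that by (auto simp: koszul_def)
    ultimately show "kbd_on B \<alpha> b \<tau> = c \<tau>" by (simp add: kbd_on_def)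
  qed
  ultimately show "\<exists>b\<in>koszul B \<alpha> (Suc p). kbd_on B \<alpha> b = c" by blast
qed

lemma acyclic_at_empty:
  fixes B :: "('v::finite \<Rightarrow> nat) set"
  assumes "\<And>\<sigma>. card \<sigma> = p \<Longrightarrow> (\<forall>v\<in>\<sigma>. 0 < \<alpha> v) \<Longrightarrow> esub \<alpha> \<sigma> \<notin> B"
  shows "acyclic_at TYPE('k::comm_ring_1) B \<alpha> p"
  unfolding acyclic_at_def
proof (intro ballI impI)
  fix c :: "'v set \<Rightarrow> 'k"
  assume "c \<in> koszul B \<alpha> p"
  then have "c = 0" using assms by (auto simp: koszul_def fun_eq_iff)
  then show "\<exists>b\<in>koszul B \<alpha> (Suc p). kbd_on B \<alpha> b = c"
    by (intro bexI[of _ 0]) (simp_all add: kbd_on_zero)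
qed

section \<open>Cochains on chains of a poset\<close>

text \<open>
The simplicial coboundary, the alternating sum over all ways of omitting one entry. The recursion peels
off the first entry. The empty list is a simplex of dimension \<open>-1\<close>, so the complex is augmented.
\<close>

primrec delta :: "('t list \<Rightarrow> 'a::ab_group_add) \<Rightarrow> 't list \<Rightarrow> 'a" where
  "delta f [] = 0"
| "delta f (x # D) = f D - delta (\<lambda>E. f (x # E)) D"

text \<open>
The prism operator between the identity and \<open>map m\<close>: the alternating sum over the lists
\<open>x\<^sub>1, \<dots>, x\<^sub>i, m x\<^sub>i, \<dots>, m x\<^sub>n\<close>. These lists are chains again if \<open>m\<close> is monotone and \<open>x \<le> m x\<close>.
\<close>

primrec prism :: "('t \<Rightarrow> 't) \<Rightarrow> ('t list \<Rightarrow> 'a::ab_group_add) \<Rightarrow> 't list \<Rightarrow> 'a" where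
  "prism m f [] = 0"
| "prism m f (x # D) = f (x # m x # map m D) - prism m (\<lambda>E. f (x # E)) D"

lemma delta_zero [simp]: "delta (\<lambda>_. 0) D = 0"
  by (induction D) auto

lemma prism_zero [simp]: "prism m (\<lambda>_. 0) D = 0"
  by (induction D) auto

lemma delta_diff: "delta (\<lambda>E. f E - g E) D = delta f D - delta g D"
  by (induction D arbitrary: f g) (auto simp: algebra_simps)

lemma prism_diff: "prism m (\<lambda>E. f E - g E) D = prism m f D - prism m g D"
  by (induction D arbitrary: f g) (auto simp: algebra_simps)

lemma delta_delta: "delta (delta f) D = 0"
proof (induction D arbitrary: f)
  case (Cons x D)
  have "delta (\<lambda>E. f E - delta (\<lambda>E. f (x # E)) E) D = delta f D - delta (delta (\<lambda>E. f (x # E))) D"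
    by (simp only: delta_diff)
  then show ?case using Cons by simp
qed simp

lemma delta_map: "delta f (map m D) = delta (\<lambda>E. f (map m E)) D"
  by (induction D arbitrary: f) auto

lemma delta_additive:
  assumes "\<And>a b. \<phi> (a - b) = \<phi> a - \<phi> (b :: 'a::ab_group_add)"
  shows "\<phi> (delta f D) = (delta (\<lambda>E. \<phi> (f E)) D :: 'b::ab_group_add)"
proof (induction D arbitrary: f)
  case Nil
  show ?case using assms[of 0 0] by simp
next
  case (Cons x D)
  show ?case using Cons by (simp add: assms)
qed

lemma delta_cong:
  assumes "\<And>E. subseq E D \<Longrightarrow> length D = Suc (length E) \<Longrightarrow> f E = g E"
  shows "delta f D = delta g D"
  using assms
proof (induction D arbitrary: f g)
  case (Cons x D)
  have "f D = g D" by (rule Cons.prems) auto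
  moreover have "delta (\<lambda>E. f (x # E)) D = delta (\<lambda>E. g (x # E)) D"
    by (rule Cons.IH, rule Cons.prems) auto
  ultimately show ?case by simp
qed simp

lemma delta_nonzeroE:
  assumes "delta f D \<noteq> 0" obtains E where "length D = Suc (length E)" "f E \<noteq> 0"
proof -
  have "\<exists>E. length D = Suc (length E) \<and> f E \<noteq> 0"
  proof (rule ccontr)
    assume "\<not> ?thesis"
    then have "delta f D = delta (\<lambda>_. 0) D" by (intro delta_cong) auto
    with assms show False by simp
  qed
  then show ?thesis using that by blast
qed

lemma prism_homotopy:
  "delta (prism m f) D + prism m (delta f) D = f (map m D) - f D"
proof (induction D arbitrary: f)
  case (Cons x D)
  let ?fx = "\<lambda>E. f (x # E)" and ?fxm = "\<lambda>E. f (x # m x # E)"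
  have 1: "delta (prism m f) (x # D) = prism m f D - delta ?fxm (map m D) + delta (prism m ?fx) D"
    by (simp add: delta_diff delta_map)
  have 2: "prism m (delta f) (x # D) =
      f (m x # map m D) - f (x # map m D) + delta ?fxm (map m D) - prism m f D + prism m (delta ?fx) D"
    by (simp add: prism_diff)
  show ?case
    unfolding 1 2 using Cons[of ?fx] by (simp add: algebra_simps)
qed simp

text \<open>
The contraction needs cochains on weakly increasing lists, because \<open>map m\<close> need not preserve
strictness, whereas the chains of bounded length are the strict ones. A cochain on strict chains is
extended by zero to the lists with equal neighbouring entries (the degenerate simplices); by
\<open>delta_normalised\<close> this extension commutes with the coboundary.
\<close>

definition normalised :: "('t list \<Rightarrow> 'a::zero) \<Rightarrow> bool" where
  "normalised f \<longleftrightarrow> (\<forall>D. \<not> distinct_adj D \<longrightarrow> f D = 0)"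

lemma normalisedD: "normalised f \<Longrightarrow> \<not> distinct_adj D \<Longrightarrow> f D = 0"
  by (simp add: normalised_def)

lemma normalised_Cons: "normalised f \<Longrightarrow> normalised (\<lambda>E. f (x # E))"
  by (auto simp: normalised_def dest: distinct_adj_ConsD)

lemma delta_normalised:
  fixes f :: "'t list \<Rightarrow> 'a::ab_group_add"
  assumes "normalised f" shows "normalised (delta f)"
proof -
  have "delta f D = 0" if "normalised f" "\<not> distinct_adj D" for D and f :: "'t list \<Rightarrow> 'a::ab_group_add"
    using that
  proof (induction D arbitrary: f)
    case (Cons x D)
    show ?case
    proof (cases "distinct_adj D")
      case False
      then show ?thesis using Cons.IH[OF normalised_Cons False] Cons.prems(1) by (simp add: normalisedD)
    next
      case True
      then obtain D' where D: "D = x # D'" using Cons.prems(2) by (cases D) (auto simp: distinct_adj_Cons)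
      have "(\<lambda>E. f (x # x # E)) = (\<lambda>_. 0)" using normalisedD[OF Cons.prems(1)] by simp
      then show ?thesis unfolding D by simp
    qed
  qed simp
  with assms show ?thesis by (simp add: normalised_def[of "delta f"])
qed

text \<open>
The prism operator only sees lists that are chains in \<open>F\<close>. The lower bound \<open>lo\<close> records the entries that
the recursion has already split off.
\<close>

lemma prism_eq_0:
  fixes h :: "'t set list \<Rightarrow> 'a::ab_group_add"
  assumes m: "\<And>x. x \<in> F \<Longrightarrow> m x \<in> F" "\<And>x. x \<subseteq> m x" "\<And>x y. x \<subseteq> y \<Longrightarrow> m x \<subseteq> m y"
    and "\<And>E. sorted_wrt (\<subseteq>) E \<Longrightarrow> set E \<subseteq> F \<Longrightarrow> (\<forall>y\<in>set E. lo \<subseteq> y) \<Longrightarrow> h E = 0"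
    and "sorted_wrt (\<subseteq>) D" "set D \<subseteq> F" "\<forall>y\<in>set D. lo \<subseteq> y"
  shows "prism m h D = 0"
  using assms(4-)
proof (induction D arbitrary: h lo)
  case (Cons x D)
  have "h (x # m x # map m D) = 0"
  proof (rule Cons.prems(1))
    have "sorted_wrt (\<subseteq>) D" using Cons.prems(2) by simp
    then have "sorted_wrt (\<subseteq>) (map m D)"
      unfolding sorted_wrt_map by (rule sorted_wrt_mono_rel[rotated]) (rule m(3))
    moreover have "x \<subseteq> m y" if "y \<in> set D" for y using that Cons.prems(2) m(2)[of y] by auto
    moreover have "m x \<subseteq> m y" if "y \<in> set D" for y using that Cons.prems(2) m(3)[of x y] by auto
    ultimately show "sorted_wrt (\<subseteq>) (x # m x # map m D)" using m(2)[of x] by auto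
    show "set (x # m x # map m D) \<subseteq> F" using Cons.prems(3) m(1) by auto
    show "\<forall>y\<in>set (x # m x # map m D). lo \<subseteq> y" using Cons.prems(4) m(2) by fastforce
  qed
  moreover have "prism m (\<lambda>E. h (x # E)) D = 0"
  proof (rule Cons.IH[where lo = x])
    fix E assume "sorted_wrt (\<subseteq>) E" "set E \<subseteq> F" "\<forall>y\<in>set E. x \<subseteq> y"
    moreover have "lo \<subseteq> x" using Cons.prems by simp
    ultimately show "h (x # E) = 0" using Cons.prems(3) by (intro Cons.prems(1)) auto
  qed (use Cons.prems in auto)
  ultimately show ?case by simp
qed simp

text \<open>
The order complex of \<open>F\<close> is contractible: the prism operator deforms the identity to
\<open>C \<mapsto> C \<union> C0\<close>, and the image of this map is a cone with apex \<open>C0\<close>.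
\<close>

lemma delta_exact:
  fixes f :: "'t set list \<Rightarrow> 'a::ab_group_add"
  assumes C0: "C0 \<in> F" "\<And>C. C \<in> F \<Longrightarrow> C \<union> C0 \<in> F"
    and cocycle: "\<And>D. sorted_wrt (\<subseteq>) D \<Longrightarrow> set D \<subseteq> F \<Longrightarrow> delta f D = 0"
  obtains g where "\<And>D. sorted_wrt (\<subseteq>) D \<Longrightarrow> set D \<subseteq> F \<Longrightarrow> delta g D = f D"
proof
  define m where "m C = C \<union> C0" for C
  let ?h = "\<lambda>D. f (C0 # map m D)"
  let ?g = "\<lambda>D. ?h D - prism m f D"
  fix D assume D: "sorted_wrt (\<subseteq>) D" "set D \<subseteq> F"
  have "sorted_wrt (\<subseteq>) (map m D)"
    unfolding sorted_wrt_map using D(1) by (rule sorted_wrt_mono_rel[rotated]) (auto simp: m_def)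
  then have "delta f (C0 # map m D) = 0"
    using C0 D(2) by (intro cocycle) (auto simp: m_def)
  then have 1: "delta ?h D = f (map m D)" by (simp add: delta_map)
  have "prism m (delta f) D = 0"
  proof (rule prism_eq_0[where F = F and lo = "{}"])
    show "m x \<in> F" if "x \<in> F" for x using that C0 by (simp add: m_def)
  qed (use D cocycle in \<open>auto simp: m_def\<close>)
  then have "delta (prism m f) D = f (map m D) - f D" using prism_homotopy[of m f D] by simp
  then show "delta ?g D = f D" by (simp add: delta_diff 1)
qed

section \<open>Koszul complexes of unions of regions\<close>

lemma sorted_wrt_psubset_iff: "sorted_wrt (\<subset>) D \<longleftrightarrow> sorted_wrt (\<subseteq>) D \<and> distinct_adj D"
proof (induction D rule: induct_list012)
  case (3 x y D)
  have "(\<forall>z\<in>set (y # D). x \<subset> z) \<longleftrightarrow> (\<forall>z\<in>set (y # D). x \<subseteq> z) \<and> x \<noteq> y" if "sorted_wrt (\<subseteq>) (y # D)"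
    using that by (simp only: sorted_wrt.simps list.set ball_simps) (metis psubset_eq psubset_subset_trans)
  then show ?case using 3(2) by (simp only: sorted_wrt.simps(2)[of _ x] distinct_adj_Cons_Cons) blast
qed simp_all

lemma subseq_set: "subseq E D \<Longrightarrow> set E \<subseteq> set D"
  by (induction rule: list_emb.induct) auto

lemma subseq_sorted_wrt: "subseq E D \<Longrightarrow> sorted_wrt P D \<Longrightarrow> sorted_wrt P E"
  by (induction rule: list_emb.induct) (auto dest: subseq_set)

text \<open>
The complex over chains \<open>D\<close> in \<open>L\<close> resolves the quotient belonging to the union of the regions \<open>B T\<close> by
the quotients belonging to the intersections over \<open>D\<close>. Its rows are exact because, at each exponent
\<open>a\<close>, they form the cochain complex of the order complex of \<open>{T\<in>L. a \<in> B T}\<close>, which is contractible by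
the assumption on joins. A chain of \<open>n\<close> elements is placed at level \<open>Suc k - n\<close>, so homological degrees
up to \<open>p + k\<close> enter.
\<close>

lemma acyclic_at_Union:
  fixes L :: "'t set set" and B :: "'t set \<Rightarrow> ('v::finite \<Rightarrow> nat) set"
  assumes down: "\<And>T. downset (B T)"
    and join: "\<And>a. a \<in> \<Union>(B ` L) \<Longrightarrow> \<exists>T0\<in>L. a \<in> B T0 \<and> (\<forall>T\<in>L. a \<in> B T \<longrightarrow> T \<union> T0 \<in> L \<and> a \<in> B (T \<union> T0))"
    and len: "\<And>D. sorted_wrt (\<subset>) D \<Longrightarrow> set D \<subseteq> L \<Longrightarrow> length D \<le> Suc k"
    and acyc: "\<And>D q. D \<noteq> [] \<Longrightarrow> sorted_wrt (\<subset>) D \<Longrightarrow> set D \<subseteq> L \<Longrightarrow> q \<le> p + k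
        \<Longrightarrow> acyclic_at TYPE('k::comm_ring_1) (\<Inter>(B ` set D)) \<alpha> q"
  shows "acyclic_at TYPE('k) (\<Union>(B ` L)) \<alpha> p"
  unfolding acyclic_at_def
proof (intro ballI impI)
  fix c :: "'v set \<Rightarrow> 'k"
  assume c: "c \<in> koszul (\<Union>(B ` L)) \<alpha> p" "kbd_on (\<Union>(B ` L)) \<alpha> c = 0"
  define ch where "ch = {D. sorted_wrt (\<subset>) D \<and> set D \<subseteq> L}"
  define R where "R D = (if D = [] then \<Union>(B ` L) else \<Inter>(B ` set D))" for D
  define A :: "nat \<Rightarrow> nat \<Rightarrow> ('t set list \<Rightarrow> 'v set \<Rightarrow> 'k) set" where
    "A l q = {f. (\<forall>D. f D \<in> koszul (R D) \<alpha> q) \<and> (\<forall>D. f D \<noteq> 0 \<longrightarrow> D \<in> ch \<and> length D + l = Suc k)}" for l q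
  define d :: "('t set list \<Rightarrow> 'v set \<Rightarrow> 'k) \<Rightarrow> 't set list \<Rightarrow> 'v set \<Rightarrow> 'k" where
    "d f D \<sigma> = (if D \<in> ch \<and> esub \<alpha> \<sigma> \<in> R D then delta (\<lambda>E. f E \<sigma>) D else 0)" for f D \<sigma>
  define e :: "('t set list \<Rightarrow> 'v set \<Rightarrow> 'k) \<Rightarrow> 't set list \<Rightarrow> 'v set \<Rightarrow> 'k" where
    "e f D = kbd_on (R D) \<alpha> (f D)" for f D
  have chD: "sorted_wrt (\<subset>) D" "set D \<subseteq> L" if "D \<in> ch" for D using that by (auto simp: ch_def)
  have ch_subseq: "E \<in> ch" if "subseq E D" "D \<in> ch" for D E
    using that(2) subseq_set[OF that(1)] subseq_sorted_wrt[OF that(1)] by (auto simp: ch_def)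
  have R_subseq: "R D \<subseteq> R E" if "subseq E D" "D \<in> ch" for D E
  proof -
    have "set E \<subseteq> set D" using that(1) by (rule subseq_set)
    then show ?thesis using chD(2)[OF that(2)] by (cases D; cases "E = []") (auto simp: R_def)
  qed
  have R_D: "a \<in> R E" if "a \<in> R D" "subseq E D" "D \<in> ch" for a D E
    using subsetD[OF R_subseq[OF that(2,3)] that(1)] .
  have R_down: "downset (R D)" for D
    using down by (auto simp: R_def downset_def)
  have A_I: "f \<in> A l q"
    if "\<And>D \<sigma>. f D \<sigma> \<noteq> 0 \<Longrightarrow> D \<in> ch \<and> length D + l = Suc k \<and> card \<sigma> = q \<and> (\<forall>v\<in>\<sigma>. 0 < \<alpha> v) \<and> esub \<alpha> \<sigma> \<in> R D"
    for f l q
    unfolding A_def koszul_def using that by (auto simp: fun_eq_iff)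
  have A_D: "D \<in> ch \<and> length D + l = Suc k \<and> card \<sigma> = q \<and> (\<forall>v\<in>\<sigma>. 0 < \<alpha> v) \<and> esub \<alpha> \<sigma> \<in> R D"
    if "f \<in> A l q" "f D \<sigma> \<noteq> 0" for f l q D \<sigma>
  proof -
    have "f D \<noteq> 0" using that(2) by auto
    then show ?thesis using that by (simp add: A_def koszul_def)
  qed
  have delta_at: "delta x D \<sigma> = delta (\<lambda>E. x E \<sigma>) D" for x :: "'t set list \<Rightarrow> 'v set \<Rightarrow> 'k" and D \<sigma>
    by (rule delta_additive[where \<phi> = "\<lambda>c. c \<sigma>"]) simp
  have d_in: "d x \<in> A l q" if "x \<in> A (Suc l) q" for x l q
  proof (rule A_I)
    fix D \<sigma> assume "d x D \<sigma> \<noteq> 0"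
    then have *: "D \<in> ch" "esub \<alpha> \<sigma> \<in> R D" "delta (\<lambda>E. x E \<sigma>) D \<noteq> 0" by (auto simp: d_def split: if_splits)
    obtain E where "length D = Suc (length E)" "x E \<sigma> \<noteq> 0" using *(3) by (rule delta_nonzeroE)
    then show "D \<in> ch \<and> length D + l = Suc k \<and> card \<sigma> = q \<and> (\<forall>v\<in>\<sigma>. 0 < \<alpha> v) \<and> esub \<alpha> \<sigma> \<in> R D"
      using *(1,2) A_D[OF that, of E \<sigma>] by simp
  qed
  have e_in: "e x \<in> A l q" if "x \<in> A l (Suc q)" for x l q
  proof -
    have "e x D \<in> koszul (R D) \<alpha> q" for D
      unfolding e_def by (rule kbd_on_in) (use that in \<open>simp add: A_def\<close>)
    moreover have "x D \<noteq> 0" if "e x D \<noteq> 0" for D using that by (auto simp: e_def)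
    ultimately show ?thesis using that unfolding A_def by simp
  qed
  have d_delta: "delta (\<lambda>E. d x E \<sigma>) D = delta (delta (\<lambda>E. x E \<sigma>)) D" if "D \<in> ch" "esub \<alpha> \<sigma> \<in> R D" for x D \<sigma>
    by (rule delta_cong) (simp add: d_def ch_subseq[OF _ that(1)] R_D[OF that(2) _ that(1)])
  have comm: "d (e x) = e (d x)" for x
  proof (intro ext)
    fix D \<tau>
    show "d (e x) D \<tau> = e (d x) D \<tau>"
    proof (cases "D \<in> ch \<and> esub \<alpha> \<tau> \<in> R D")
      case True
      then have "d (e x) D \<tau> = delta (\<lambda>E. e x E \<tau>) D" by (simp add: d_def)
      also have "\<dots> = delta (\<lambda>E. kbd (\<lambda>_. 1) (x E) \<tau>) D"
        by (rule delta_cong) (use True R_D[of "esub \<alpha> \<tau>" D] in \<open>simp add: e_def kbd_on_def\<close>)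
      also have "\<dots> = kbd (\<lambda>_. 1) (delta x D) \<tau>"
        by (rule delta_additive[where \<phi> = "\<lambda>c. kbd (\<lambda>_. 1) c \<tau>", symmetric]) (rule kbd_diff)
      also have "\<dots> = kbd (\<lambda>_. 1) (d x D) \<tau>"
      proof (rule kbd_cong_insert)
        fix v
        have "esub \<alpha> (insert v \<tau>) \<in> R D"
          by (rule downsetD[OF R_down]) (use True in \<open>auto intro: esub_mono\<close>)
        then show "delta x D (insert v \<tau>) = d x D (insert v \<tau>)" using True by (simp add: d_def delta_at)
      qed
      finally show ?thesis using True by (simp add: e_def kbd_on_def)
    next
      case False
      have "d x D = 0" if "D \<notin> ch" using that by (intro ext) (simp add: d_def)
      then show ?thesis using False by (auto simp: d_def e_def kbd_on_def[of "R D" \<alpha> "d x D" \<tau>] kbd_def)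
    qed
  qed
  have d_exact: "\<exists>y\<in>A (Suc l) q. d y = z" if z: "z \<in> A l q" and dz: "d z = 0" for l q z
  proof -
    have "\<exists>g. \<forall>D. sorted_wrt (\<subseteq>) D \<longrightarrow> set D \<subseteq> {T\<in>L. esub \<alpha> \<sigma> \<in> B T} \<longrightarrow> delta g D = z D \<sigma>" for \<sigma>
    proof (cases "esub \<alpha> \<sigma> \<in> \<Union>(B ` L)")
      case False
      then have "z [] \<sigma> = 0" using A_D[OF z, of "[]" \<sigma>] by (auto simp: R_def)
      moreover have "D = []" if "set D \<subseteq> {T\<in>L. esub \<alpha> \<sigma> \<in> B T}" for D using that False by (cases D) auto
      ultimately show ?thesis by (intro exI[of _ "\<lambda>_. 0"]) auto
    next
      case True
      obtain T0 where T0: "T0 \<in> L" "esub \<alpha> \<sigma> \<in> B T0"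
        "\<And>T. T \<in> L \<Longrightarrow> esub \<alpha> \<sigma> \<in> B T \<Longrightarrow> T \<union> T0 \<in> L \<and> esub \<alpha> \<sigma> \<in> B (T \<union> T0)"
        using join[OF True] by blast
      have norm: "normalised (\<lambda>E. z E \<sigma>)"
        unfolding normalised_def
      proof (intro allI impI)
        fix E :: "'t set list" assume "\<not> distinct_adj E"
        then have "E \<notin> ch" by (auto simp: ch_def sorted_wrt_psubset_iff)
        then show "z E \<sigma> = 0" using A_D[OF z, of E \<sigma>] by blast
      qed
      show ?thesis
      proof (rule delta_exact[of T0 "{T\<in>L. esub \<alpha> \<sigma> \<in> B T}" "\<lambda>E. z E \<sigma>"])
        fix D assume D: "sorted_wrt (\<subseteq>) D" "set D \<subseteq> {T\<in>L. esub \<alpha> \<sigma> \<in> B T}"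
        show "delta (\<lambda>E. z E \<sigma>) D = 0"
        proof (cases "distinct_adj D \<and> D \<noteq> []")
          case True
          then have "D \<in> ch" "esub \<alpha> \<sigma> \<in> R D" using D by (auto simp: ch_def sorted_wrt_psubset_iff R_def)
          then show ?thesis using fun_cong[OF fun_cong[OF dz], of D \<sigma>] by (simp add: d_def)
        next
          case False
          then show ?thesis using normalisedD[OF delta_normalised[OF norm], of D] by (cases "D = []") simp_all
        qed
      qed (use T0 in auto)
    qed
    then obtain g where g: "\<And>\<sigma> D. sorted_wrt (\<subseteq>) D \<Longrightarrow> set D \<subseteq> {T\<in>L. esub \<alpha> \<sigma> \<in> B T} \<Longrightarrow> delta (g \<sigma>) D = z D \<sigma>"
      by metis
    define ok where "ok l D \<sigma> \<longleftrightarrow> D \<in> ch \<and> length D + l = Suc k \<and> card \<sigma> = q \<and> (\<forall>v\<in>\<sigma>. 0 < \<alpha> v) \<and> esub \<alpha> \<sigma> \<in> R D" for l D \<sigma>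
    define y where "y D \<sigma> = (if ok (Suc l) D \<sigma> then g \<sigma> D else 0)" for D \<sigma>
    have "y \<in> A (Suc l) q" by (rule A_I) (auto simp: y_def ok_def split: if_splits)
    moreover have "d y = z"
    proof (intro ext)
      fix D \<sigma>
      show "d y D \<sigma> = z D \<sigma>"
      proof (cases "ok l D \<sigma>")
        case True
        then have "d y D \<sigma> = delta (\<lambda>E. y E \<sigma>) D" by (simp add: d_def ok_def)
        also have "\<dots> = delta (g \<sigma>) D"
        proof (rule delta_cong)
          fix E assume E: "subseq E D" "length D = Suc (length E)"
          then have "ok (Suc l) E \<sigma>" using True ch_subseq[of E D] R_D[of "esub \<alpha> \<sigma>" D E] by (simp add: ok_def)
          then show "y E \<sigma> = g \<sigma> E" by (simp add: y_def)
        qed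
        also have "\<dots> = z D \<sigma>"
        proof (rule g)
          show "sorted_wrt (\<subseteq>) D" using True by (simp add: ok_def ch_def sorted_wrt_psubset_iff)
          show "set D \<subseteq> {T\<in>L. esub \<alpha> \<sigma> \<in> B T}" using True by (auto simp: ok_def ch_def R_def split: if_splits)
        qed
        finally show ?thesis .
      next
        case False
        then have "z D \<sigma> = 0" using A_D[OF z, of D \<sigma>] unfolding ok_def by blast
        moreover have "d y D \<sigma> = 0"
        proof (rule ccontr)
          assume *: "d y D \<sigma> \<noteq> 0"
          then show False using A_D[OF d_in[OF \<open>y \<in> A (Suc l) q\<close>] *] False by (simp add: ok_def)
        qed
        ultimately show ?thesis by simp
      qed
    qed
    ultimately show ?thesis by blast
  qed
  have e_exact: "\<exists>y\<in>A l (Suc q). e y = z" if z: "z \<in> A l q" "e z = 0" and l: "l \<le> k" "q \<le> p + k" for l q z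
  proof -
    have "\<exists>b\<in>koszul (R D) \<alpha> (Suc q). kbd_on (R D) \<alpha> b = z D \<and> (z D = 0 \<longrightarrow> b = 0)" for D
    proof (cases "z D = 0")
      case True
      then show ?thesis by (intro bexI[of _ 0]) auto
    next
      case False
      then have D: "D \<in> ch" "length D + l = Suc k" "z D \<in> koszul (R D) \<alpha> q" using z(1) by (auto simp: A_def)
      have "acyclic_at TYPE('k) (R D) \<alpha> q" using acyc[of D q] D(1,2) l by (auto simp: R_def ch_def)
      moreover have "kbd_on (R D) \<alpha> (z D) = 0" using fun_cong[OF z(2), of D] by (simp add: e_def)
      ultimately show ?thesis using D(3) False unfolding acyclic_at_def by blast
    qed
    then obtain y where y: "\<And>D. y D \<in> koszul (R D) \<alpha> (Suc q)" "\<And>D. kbd_on (R D) \<alpha> (y D) = z D" "\<And>D. z D = 0 \<Longrightarrow> y D = 0"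
      by metis
    have "y \<in> A l (Suc q)" using y(1,3) z(1) by (auto simp: A_def)
    moreover have "e y = z" by (rule ext) (simp add: e_def y(2))
    ultimately show ?thesis by blast
  qed
  define z0 where "z0 D = (if D = [] then c else 0)" for D :: "'t set list"
  have z0: "z0 \<in> A (Suc k) p" using c(1) by (auto simp: A_def z0_def R_def ch_def)
  have "e z0 = 0" by (rule ext) (simp add: e_def z0_def R_def c(2))
  have d0: "d 0 = 0" by (intro ext) (simp add: d_def)
  have "\<exists>y\<in>A (Suc (Suc k)) p. \<exists>w\<in>A (Suc k) (Suc p). z0 = d y + e w"
  proof (rule staircase[of A "\<lambda>_. d" "\<lambda>_. e"])
    show "\<exists>y\<in>A 1 q. d y = z" if z: "z \<in> A 0 q" for q z
    proof -
      have "d z D \<sigma> = 0" for D \<sigma>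
      proof (rule ccontr)
        assume "d z D \<sigma> \<noteq> 0"
        then have *: "D \<in> ch" "delta (\<lambda>E. z E \<sigma>) D \<noteq> 0" by (auto simp: d_def split: if_splits)
        obtain E where "length D = Suc (length E)" "z E \<sigma> \<noteq> 0" using *(2) by (rule delta_nonzeroE)
        then show False using A_D[OF z, of E \<sigma>] len[of D] *(1) by (simp add: ch_def)
      qed
      then have "d z = 0" by (intro ext) simp
      then show ?thesis using d_exact[OF z] by simp
    qed
    show "\<exists>z'\<in>A l (Suc p). d z0 = e z'" if "Suc k = Suc l" for l
    proof -
      have "\<exists>y\<in>A k (Suc p). e y = d z0"
        by (rule e_exact) (use d_in z0 comm \<open>e z0 = 0\<close> d0 in \<open>auto simp flip: comm\<close>)
      then show ?thesis using that by (metis nat.inject)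
    qed
    show "x - y \<in> A l q" if "x \<in> A l q" "y \<in> A l q" for l q x y
    proof -
      have "D \<in> ch \<and> length D + l = Suc k" if "(x - y) D \<noteq> 0" for D
      proof -
        have "x D \<noteq> 0 \<or> y D \<noteq> 0" using that by auto
        then show ?thesis using \<open>x \<in> A l q\<close> \<open>y \<in> A l q\<close> unfolding A_def by blast
      qed
      moreover have "(x - y) D \<in> koszul (R D) \<alpha> q" for D
        using \<open>x \<in> A l q\<close> \<open>y \<in> A l q\<close> by (simp add: A_def koszul_diff)
      ultimately show ?thesis unfolding A_def by blast
    qed
    show "d (x - y) = d x - d y" for x y by (intro ext) (simp add: d_def delta_diff)
    show "e (x - y) = e x - e y" for x y by (intro ext) (simp add: e_def kbd_on_diff)
    show "d (d x) = 0" for x by (intro ext) (simp add: d_def[of "d x"] d_delta delta_delta)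
    show "e (e x) = 0" for x by (rule ext) (simp add: e_def kbd_on_kbd_on R_down)
    show "\<exists>y\<in>A l (Suc (Suc q)). e y = z"
      if "Suc (Suc l) \<le> Suc k" "Suc l + Suc q = Suc k + p" "z \<in> A l (Suc q)" "e z = 0" for l q z
      using e_exact[OF that(3,4)] that(1,2) by simp
    show "0 \<in> A l q" for l q by (simp add: A_def)
  qed (use d_in e_in comm d_exact z0 in auto)
  then obtain y w where yw: "y \<in> A (Suc (Suc k)) p" "w \<in> A (Suc k) (Suc p)" "z0 = d y + e w" by blast
  have "y = 0" using yw(1) by (intro ext) (auto simp: A_def)
  then have "z0 [] = e w []" using yw(3) d0 by simp
  then have "kbd_on (\<Union>(B ` L)) \<alpha> (w []) = c" by (simp add: z0_def e_def R_def)
  moreover have "w [] \<in> koszul (\<Union>(B ` L)) \<alpha> (Suc p)" using yw(2) by (auto simp: A_def R_def dest: spec[of _ "[]"])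
  ultimately show "\<exists>b\<in>koszul (\<Union>(B ` L)) \<alpha> (Suc p). kbd_on (\<Union>(B ` L)) \<alpha> b = c" by blast
qed

section \<open>Koszul complexes over the polynomial ring\<close>

lemma esub_insert:
  assumes "v \<notin> \<tau>"
  shows "esub \<alpha> (insert v \<tau>) = (esub \<alpha> \<tau>)(v := \<alpha> v - 1)"
  using assms by (auto simp: esub_def)

lemma acyclic_at_UNIV:
  fixes \<alpha> :: "'v::finite \<Rightarrow> nat"
  assumes "\<alpha> \<noteq> 0"
  shows "acyclic_at TYPE('k::comm_ring_1) UNIV \<alpha> p"
proof -
  obtain v where "\<alpha> v \<noteq> 0" using assms by (auto simp: fun_eq_iff)
  then show ?thesis by (intro acyclic_at_cone[of _ v]) auto
qed

text \<open>
The Koszul complex of the ideal \<open>J\<close> spanned by the monomials outside \<open>B\<close>. From the exact sequence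
\<open>0 \<rightarrow> J \<rightarrow> R \<rightarrow> R/J \<rightarrow> 0\<close> and the acyclicity of \<open>R\<close>, the homology of \<open>J\<close> in degree \<open>p\<close> is that of
\<open>R/J\<close> in degree \<open>p + 1\<close>. The complex of \<open>J\<close> carries the plain differential \<open>kbd\<close>, because an ideal is
closed under multiplication.
\<close>

lemma koszul_complement_exact:
  fixes \<alpha> :: "'v::finite \<Rightarrow> nat" and c :: "'v set \<Rightarrow> 'k::comm_ring_1"
  assumes B: "downset B" "acyclic_at TYPE('k) B \<alpha> (Suc p)" and "\<alpha> \<noteq> 0"
    and c: "c \<in> koszul (-B) \<alpha> p" "kbd (\<lambda>_. 1) c = 0"
  obtains b where "b \<in> koszul (-B) \<alpha> (Suc p)" "kbd (\<lambda>_. 1) b = c"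
proof -
  have U: "kbd_on UNIV \<alpha> x = kbd (\<lambda>_. 1) x" for x :: "'v set \<Rightarrow> 'k" by (rule ext) (simp add: kbd_on_def)
  have "c \<in> koszul UNIV \<alpha> p" using c(1) by (simp add: koszul_def)
  then obtain b0 where b0: "b0 \<in> koszul UNIV \<alpha> (Suc p)" "kbd (\<lambda>_. 1) b0 = c"
    using acyclic_at_UNIV[OF \<open>\<alpha> \<noteq> 0\<close>, where p = p and 'k = 'k] c(2) unfolding acyclic_at_def U by blast
  define b1 where "b1 \<sigma> = (if esub \<alpha> \<sigma> \<in> B then b0 \<sigma> else 0)" for \<sigma>
  have b1: "b1 \<in> koszul B \<alpha> (Suc p)" using b0(1) by (simp add: koszul_def b1_def)
  have "kbd_on B \<alpha> b1 \<tau> = 0" for \<tau>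
  proof (cases "esub \<alpha> \<tau> \<in> B")
    case True
    have "kbd (\<lambda>_. 1) b1 \<tau> = kbd (\<lambda>_. 1) b0 \<tau>"
    proof (rule kbd_cong_insert)
      fix v
      have "esub \<alpha> (insert v \<tau>) \<in> B" by (rule downsetD[OF B(1) True]) (auto intro: esub_mono)
      then show "b1 (insert v \<tau>) = b0 (insert v \<tau>)" by (simp add: b1_def)
    qed
    also have "\<dots> = 0"
    proof -
      have "c \<tau> \<noteq> 0 \<Longrightarrow> esub \<alpha> \<tau> \<in> -B" using c(1) unfolding koszul_def by blast
      then show ?thesis using True b0(2) by auto
    qed
    finally show ?thesis by (simp add: kbd_on_def)
  qed (simp add: kbd_on_def)
  then have "kbd_on B \<alpha> b1 = 0" by (intro ext) simp
  then obtain b2 where b2: "b2 \<in> koszul B \<alpha> (Suc (Suc p))" "kbd_on B \<alpha> b2 = b1"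
    using B(2) b1 unfolding acyclic_at_def by blast
  let ?b = "b0 - kbd (\<lambda>_. 1) b2"
  have "b2 \<in> koszul UNIV \<alpha> (Suc (Suc p))" using b2(1) by (simp add: koszul_def)
  then have "?b \<in> koszul UNIV \<alpha> (Suc p)" using koszul_diff[OF b0(1) kbd_on_in] U by metis
  moreover have "?b \<sigma> = 0" if "esub \<alpha> \<sigma> \<in> B" for \<sigma>
    using fun_cong[OF b2(2), of \<sigma>] that by (simp add: kbd_on_def b1_def)
  ultimately have "?b \<in> koszul (-B) \<alpha> (Suc p)" unfolding koszul_def by (auto simp del: fun_diff_def)
  moreover have "kbd (\<lambda>_. 1) ?b = c"
    using b0(2) by (intro ext) (simp add: kbd_diff kbd_kbd)
  ultimately show ?thesis using that by blast
qed

definition monomial_of :: "('v::finite \<Rightarrow> nat) \<Rightarrow> 'v \<Rightarrow>\<^sub>0 nat" where "monomial_of f = Abs_poly_mapping f"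

lemma lookup_monomial_of [simp]: "Poly_Mapping.lookup (monomial_of f) = f"
  by (simp add: monomial_of_def)

lemma monomial_of_lookup [simp]: "monomial_of (Poly_Mapping.lookup m) = m"
  by (simp add: monomial_of_def)

text \<open>
A chain of polynomials is the same as a family of scalar chains, one for each multidegree \<open>\<alpha>\<close>: the
coefficient at \<open>\<sigma>\<close> is that of the monomial \<open>x\<^sup>\<alpha> / x\<^sup>\<sigma>\<close>.
\<close>

definition multidegree_part :: "('v::finite \<Rightarrow> nat) \<Rightarrow> ('v set \<Rightarrow> ('v, 'k::comm_ring_1) mpol) \<Rightarrow> 'v set \<Rightarrow> 'k" where
  "multidegree_part \<alpha> c \<sigma> = (if \<forall>v\<in>\<sigma>. 0 < \<alpha> v then Poly_Mapping.lookup (c \<sigma>) (monomial_of (esub \<alpha> \<sigma>)) else 0)"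

lemma lookup_var_mult:
  fixes p :: "('v, 'k::comm_ring_1) mpol"
  shows "Poly_Mapping.lookup (var v * p) m =
    (if Poly_Mapping.lookup m v = 0 then 0 else Poly_Mapping.lookup p (m - Poly_Mapping.single v 1))"
proof -
  let ?x = "Poly_Mapping.single v (1::nat)"
  have 1: "Poly_Mapping.lookup (var v * p) m = (\<Sum>q. Poly_Mapping.lookup p q when m = ?x + q)"
    by (simp add: var_def lookup_mult lookup_single when_mult)
  show ?thesis
  proof (cases "Poly_Mapping.lookup m v = 0")
    case True
    then have "m \<noteq> ?x + q" for q by (auto simp: lookup_add)
    then show ?thesis using True 1 by simp
  next
    case False
    have "?x + (m - ?x) = m"
      by (rule poly_mapping_eqI) (use False in \<open>auto simp: lookup_add lookup_minus lookup_single when_def\<close>)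
    then have "m = ?x + q \<longleftrightarrow> q = m - ?x" for q by (metis add_diff_cancel_left')
    then show ?thesis using False 1 by simp
  qed
qed

lemma lookup_ksgn_mult: "Poly_Mapping.lookup (ksgn v \<sigma> * (p :: ('v::finite, 'k::comm_ring_1) mpol)) m = ksgn v \<sigma> * Poly_Mapping.lookup p m"
proof -
  have "Poly_Mapping.lookup ((-1) ^ n * p) m = (-1) ^ n * Poly_Mapping.lookup p m" for n
    by (induction n) (auto simp: mult.assoc)
  then show ?thesis by (simp add: ksgn_def)
qed

lemma kbd_multidegree_part:
  fixes c :: "'v::finite set \<Rightarrow> ('v, 'k::comm_ring_1) mpol"
  shows "kbd (\<lambda>_. 1) (multidegree_part \<alpha> c) \<tau> = multidegree_part \<alpha> (kbd var c) \<tau>"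
proof (cases "\<forall>v\<in>\<tau>. 0 < \<alpha> v")
  case False
  then have "\<not> (\<forall>w\<in>insert v \<tau>. 0 < \<alpha> w)" for v by blast
  then have "multidegree_part \<alpha> c (insert v \<tau>) = 0" for v unfolding multidegree_part_def by (rule if_not_P)
  moreover have "multidegree_part \<alpha> (kbd var c) \<tau> = 0" unfolding multidegree_part_def using False by (rule if_not_P)
  ultimately show ?thesis by (simp add: kbd_def)
next
  case True
  have "Poly_Mapping.lookup (ksgn v \<tau> * var v * c (insert v \<tau>)) (monomial_of (esub \<alpha> \<tau>)) = ksgn v \<tau> * multidegree_part \<alpha> c (insert v \<tau>)"
    if "v \<notin> \<tau>" for v
  proof -
    have "monomial_of (esub \<alpha> \<tau>) - Poly_Mapping.single v 1 = monomial_of (esub \<alpha> (insert v \<tau>))"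
      by (rule poly_mapping_eqI) (use that in \<open>auto simp: lookup_minus esub_insert lookup_single when_def esub_def\<close>)
    moreover have "esub \<alpha> \<tau> v = \<alpha> v" using that by (simp add: esub_def)
    ultimately show ?thesis
      using True by (auto simp: mult.assoc lookup_ksgn_mult lookup_var_mult multidegree_part_def)
  qed
  then have "kbd (\<lambda>_. 1) (multidegree_part \<alpha> c) \<tau> = (\<Sum>v\<in>-\<tau>. Poly_Mapping.lookup (ksgn v \<tau> * var v * c (insert v \<tau>)) (monomial_of (esub \<alpha> \<tau>)))"
    by (simp add: kbd_def)
  also have "\<dots> = multidegree_part \<alpha> (kbd var c) \<tau>"
    using True by (simp add: multidegree_part_def kbd_def lookup_sum)
  finally show ?thesis .
qed

definition eadd :: "('v::finite \<Rightarrow>\<^sub>0 nat) \<Rightarrow> 'v set \<Rightarrow> 'v \<Rightarrow> nat" where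
  "eadd m \<sigma> v = (if v \<in> \<sigma> then Suc (Poly_Mapping.lookup m v) else Poly_Mapping.lookup m v)"

lemma esub_eadd [simp]: "esub (eadd m \<sigma>) \<sigma> = Poly_Mapping.lookup m"
  by (auto simp: esub_def eadd_def)

lemma eadd_esub: "\<forall>v\<in>\<sigma>. 0 < \<alpha> v \<Longrightarrow> eadd (monomial_of (esub \<alpha> \<sigma>)) \<sigma> = \<alpha>"
  by (auto simp: esub_def eadd_def)

lemma eadd_pos: "v \<in> \<sigma> \<Longrightarrow> 0 < eadd m \<sigma> v"
  by (simp add: eadd_def)

lemma lookup_eq_multidegree_part: "Poly_Mapping.lookup (c \<sigma>) m = multidegree_part (eadd m \<sigma>) c \<sigma>"
  by (simp add: multidegree_part_def eadd_pos)

lemma sum_eadd: "sum (eadd m \<sigma>) UNIV = monom_deg m + card \<sigma>"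
proof -
  have "sum (eadd m \<sigma>) UNIV = (\<Sum>v\<in>UNIV. Poly_Mapping.lookup m v + (if v \<in> \<sigma> then 1 else 0))"
    by (rule sum.cong) (auto simp: eadd_def)
  then show ?thesis by (simp add: sum.distrib monom_deg_def sum.If_cases)
qed

lemma finite_monom_deg_le: "finite {m :: 'v::finite \<Rightarrow>\<^sub>0 nat. monom_deg m \<le> N}"
proof -
  have "{m :: 'v \<Rightarrow>\<^sub>0 nat. monom_deg m \<le> N} \<subseteq> monomial_of ` PiE UNIV (\<lambda>_. {..N})"
  proof
    fix m :: "'v \<Rightarrow>\<^sub>0 nat" assume "m \<in> {m. monom_deg m \<le> N}"
    then have "Poly_Mapping.lookup m v \<le> N" for v
      using member_le_sum[of v UNIV "Poly_Mapping.lookup m"] by (simp add: monom_deg_def)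
    then show "m \<in> monomial_of ` PiE UNIV (\<lambda>_. {..N})"
      by (intro image_eqI[of _ _ "Poly_Mapping.lookup m"]) auto
  qed
  then show ?thesis by (rule finite_subset) (intro finite_imageI finite_PiE; simp)
qed

text \<open>
Boundaries are found separately in each multidegree. Homogeneity leaves only finitely many of these,
which is what makes the solutions fit together to polynomials. The condition \<open>const\<close> excludes the class
of \<open>1\<close> in multidegree \<open>0\<close>, the only homology of the Koszul complex of \<open>R\<close>.
\<close>

lemma kbd_poly_exact:
  fixes c :: "'v::finite set \<Rightarrow> ('v, 'k::comm_ring_1) mpol" and j :: int
  assumes B: "downset B" "\<And>\<alpha>. int (sum \<alpha> UNIV) = j \<Longrightarrow> acyclic_at TYPE('k) B \<alpha> (Suc p)"
    and card: "\<And>\<sigma>. c \<sigma> \<noteq> 0 \<Longrightarrow> card \<sigma> = p"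
    and hom: "\<And>\<sigma>. homogeneous (j - int p) (c \<sigma>)"
    and keys: "\<And>\<sigma> m. m \<in> Poly_Mapping.keys (c \<sigma>) \<Longrightarrow> Poly_Mapping.lookup m \<notin> B"
    and const: "Poly_Mapping.lookup (c {}) 0 = 0"
    and cyc: "kbd var c = 0"
  obtains b where "\<And>\<sigma>. b \<sigma> \<noteq> 0 \<Longrightarrow> card \<sigma> = Suc p" "\<And>\<sigma>. homogeneous (j - int (Suc p)) (b \<sigma>)"
    "\<And>\<sigma> m. m \<in> Poly_Mapping.keys (b \<sigma>) \<Longrightarrow> Poly_Mapping.lookup m \<notin> B" "kbd var b = c"
proof -
  have "\<exists>b. b \<in> koszul (-B) \<alpha> (Suc p) \<and> kbd (\<lambda>_. 1) b = multidegree_part \<alpha> c" if j: "int (sum \<alpha> UNIV) = j" for \<alpha>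
  proof (cases "\<alpha> = 0")
    case True
    have "multidegree_part \<alpha> c \<sigma> = 0" for \<sigma>
    proof (cases "\<sigma> = {}")
      case True
      have "monomial_of 0 = (0 :: 'v \<Rightarrow>\<^sub>0 nat)" by (rule poly_mapping_eqI) simp
      then show ?thesis using const \<open>\<alpha> = 0\<close> True by (simp add: multidegree_part_def)
    next
      case False
      then show ?thesis using \<open>\<alpha> = 0\<close> by (auto simp: multidegree_part_def)
    qed
    then have "kbd (\<lambda>_. 1) 0 = multidegree_part \<alpha> c" by (intro ext) (simp add: kbd_def)
    then show ?thesis by (intro exI[of _ 0]) simp
  next
    case False
    have "multidegree_part \<alpha> c \<in> koszul (-B) \<alpha> p"
    proof -
      have "card \<sigma> = p \<and> (\<forall>v\<in>\<sigma>. 0 < \<alpha> v) \<and> esub \<alpha> \<sigma> \<in> -B" if "multidegree_part \<alpha> c \<sigma> \<noteq> 0" for \<sigma>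
      proof -
        have *: "\<forall>v\<in>\<sigma>. 0 < \<alpha> v" "Poly_Mapping.lookup (c \<sigma>) (monomial_of (esub \<alpha> \<sigma>)) \<noteq> 0"
          using that by (auto simp: multidegree_part_def split: if_splits)
        then have "monomial_of (esub \<alpha> \<sigma>) \<in> Poly_Mapping.keys (c \<sigma>)" by (simp add: in_keys_iff)
        then show ?thesis using * keys[of "monomial_of (esub \<alpha> \<sigma>)" \<sigma>] card[of \<sigma>] by (cases "c \<sigma> = 0") auto
      qed
      then show ?thesis by (simp add: koszul_def)
    qed
    moreover have "kbd (\<lambda>_. 1) (multidegree_part \<alpha> c) = 0"
      by (rule ext) (simp add: kbd_multidegree_part cyc multidegree_part_def)
    ultimately show ?thesis using koszul_complement_exact[OF B(1) B(2)[OF j] False] by metis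
  qed
  then obtain \<beta> where \<beta>: "\<And>\<alpha>. int (sum \<alpha> UNIV) = j \<Longrightarrow> \<beta> \<alpha> \<in> koszul (-B) \<alpha> (Suc p)"
    "\<And>\<alpha>. int (sum \<alpha> UNIV) = j \<Longrightarrow> kbd (\<lambda>_. 1) (\<beta> \<alpha>) = multidegree_part \<alpha> c" by metis
  define h where "h \<sigma> m = (if int (sum (eadd m \<sigma>) UNIV) = j then \<beta> (eadd m \<sigma>) \<sigma> else 0)" for \<sigma> m
  have "finite {m. h \<sigma> m \<noteq> 0}" for \<sigma>
  proof (rule finite_subset)
    show "{m. h \<sigma> m \<noteq> 0} \<subseteq> {m. monom_deg m \<le> nat j}" by (auto simp: h_def sum_eadd split: if_splits)
  qed (rule finite_monom_deg_le)
  define b where "b \<sigma> = Abs_poly_mapping (h \<sigma>)" for \<sigma>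
  have lb: "Poly_Mapping.lookup (b \<sigma>) = h \<sigma>" for \<sigma> by (simp add: b_def \<open>finite {m. h \<sigma> m \<noteq> 0}\<close>)
  have h: "int (sum (eadd m \<sigma>) UNIV) = j \<and> card \<sigma> = Suc p \<and> Poly_Mapping.lookup m \<notin> B" if "h \<sigma> m \<noteq> 0" for \<sigma> m
  proof -
    have 1: "int (sum (eadd m \<sigma>) UNIV) = j" "\<beta> (eadd m \<sigma>) \<sigma> \<noteq> 0" using that by (auto simp: h_def split: if_splits)
    then show ?thesis using \<beta>(1)[OF 1(1)] unfolding koszul_def by auto
  qed
  have comp_b: "multidegree_part \<alpha> b \<sigma> = (if int (sum \<alpha> UNIV) = j then \<beta> \<alpha> \<sigma> else 0)" for \<alpha> \<sigma>
  proof (cases "\<forall>v\<in>\<sigma>. 0 < \<alpha> v")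
    case True
    then show ?thesis by (simp add: multidegree_part_def lb h_def eadd_esub)
  next
    case False
    then have "int (sum \<alpha> UNIV) = j \<Longrightarrow> \<beta> \<alpha> \<sigma> = 0" using \<beta>(1)[of \<alpha>] unfolding koszul_def by blast
    then show ?thesis using False by (auto simp: multidegree_part_def)
  qed
  show ?thesis
  proof
    show "card \<sigma> = Suc p" if "b \<sigma> \<noteq> 0" for \<sigma>
    proof -
      obtain m where "h \<sigma> m \<noteq> 0" using \<open>b \<sigma> \<noteq> 0\<close> lb by (metis lookup_zero poly_mapping_eqI)
      then show ?thesis using h by blast
    qed
    show "homogeneous (j - int (Suc p)) (b \<sigma>)" for \<sigma>
      using h by (fastforce simp: homogeneous_def in_keys_iff lb sum_eadd)
    show "Poly_Mapping.lookup m \<notin> B" if "m \<in> Poly_Mapping.keys (b \<sigma>)" for \<sigma> m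
      using that h by (auto simp: in_keys_iff lb)
    show "kbd var b = c"
    proof (intro ext poly_mapping_eqI)
      fix \<tau> :: "'v set" and m
      let ?\<alpha> = "eadd m \<tau>"
      have "Poly_Mapping.lookup (kbd var b \<tau>) m = kbd (\<lambda>_. 1) (multidegree_part ?\<alpha> b) \<tau>"
        by (simp add: kbd_multidegree_part lookup_eq_multidegree_part)
      also have "\<dots> = (if int (sum ?\<alpha> UNIV) = j then multidegree_part ?\<alpha> c \<tau> else 0)"
      proof (cases "int (sum ?\<alpha> UNIV) = j")
        case True
        then have "multidegree_part ?\<alpha> b = \<beta> ?\<alpha>" by (intro ext) (simp add: comp_b)
        then show ?thesis using \<beta>(2)[OF True] True by simp
      next
        case False
        then have "multidegree_part ?\<alpha> b \<sigma> = 0" for \<sigma> by (simp add: comp_b)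
        then show ?thesis using False by (simp add: kbd_def)
      qed
      also have "\<dots> = Poly_Mapping.lookup (c \<tau>) m"
      proof (cases "Poly_Mapping.lookup (c \<tau>) m = 0")
        case False
        then have "int (monom_deg m) = j - int p" "c \<tau> \<noteq> 0"
          using hom[of \<tau>] by (auto simp: homogeneous_def in_keys_iff)
        then have "int (sum ?\<alpha> UNIV) = j" using card[of \<tau>] by (simp add: sum_eadd)
        then show ?thesis by (simp add: lookup_eq_multidegree_part)
      qed (simp add: lookup_eq_multidegree_part)
      finally show "Poly_Mapping.lookup (kbd var b \<tau>) m = Poly_Mapping.lookup (c \<tau>) m" .
    qed
  qed
qed

section \<open>Betti numbers and Koszul homology\<close>

lemma homogeneous_zero [simp]: "homogeneous d 0"
  by (simp add: homogeneous_def)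

lemma homogeneous_add: "homogeneous d p \<Longrightarrow> homogeneous d q \<Longrightarrow> homogeneous d (p + q)"
  unfolding homogeneous_def using Poly_Mapping.keys_add[of p q] by blast

lemma homogeneous_minus: "homogeneous d p \<Longrightarrow> homogeneous d q \<Longrightarrow> homogeneous d (p - q)"
  unfolding homogeneous_def using keys_diff[of p q] by blast

lemma homogeneous_sum: "(\<And>i. i \<in> S \<Longrightarrow> homogeneous d (p i)) \<Longrightarrow> homogeneous d (sum p S)"
  by (induction S rule: infinite_finite_induct) (auto intro: homogeneous_add)

lemma monom_deg_add: "monom_deg (m + n) = monom_deg m + monom_deg n"
  by (simp add: monom_deg_def lookup_add sum.distrib)

lemma homogeneous_mult: "homogeneous d p \<Longrightarrow> homogeneous e q \<Longrightarrow> homogeneous (d + e) (p * q)"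
  unfolding homogeneous_def using keys_mult[of p q] by (fastforce simp: monom_deg_add)

lemma homogeneous_one: "homogeneous 0 1"
  by (auto simp: homogeneous_def monom_deg_def in_keys_iff lookup_one when_def split: if_splits)

lemma monom_deg_single [simp]: "monom_deg (Poly_Mapping.single v n) = n"
  by (simp add: monom_deg_def lookup_single when_def)

lemma homogeneous_var: "homogeneous 1 (var v)"
  by (simp add: homogeneous_def var_def)

lemma keys_ksgn_mult: "Poly_Mapping.keys (ksgn v \<sigma> * p) \<subseteq> Poly_Mapping.keys (p :: ('v::finite, 'k::comm_ring_1) mpol)"
  by (auto simp: in_keys_iff lookup_ksgn_mult)

lemma homogeneous_kbd:
  assumes "\<And>\<sigma>. homogeneous (d - 1) (c \<sigma>)"
  shows "homogeneous d (kbd var c \<tau>)"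
proof -
  have "homogeneous d (ksgn v \<tau> * (var v * c \<sigma>))" for v \<sigma>
    using homogeneous_mult[OF homogeneous_var[of v] assms[of \<sigma>]] keys_ksgn_mult[of v \<tau> "var v * c \<sigma>"]
    unfolding homogeneous_def by auto
  then show ?thesis unfolding kbd_def by (intro homogeneous_sum) (simp add: mult.assoc)
qed

lemma keys_avoid_mult:
  fixes p q :: "('v::finite, 'k::comm_ring_1) mpol" and B :: "('v \<Rightarrow> nat) set"
  assumes "downset B" "\<And>m. m \<in> Poly_Mapping.keys p \<Longrightarrow> Poly_Mapping.lookup m \<notin> B"
    and "m \<in> Poly_Mapping.keys (q * p)"
  shows "Poly_Mapping.lookup m \<notin> B"
proof -
  obtain a b where ab: "m = a + b" "b \<in> Poly_Mapping.keys p" using keys_mult[of q p] assms(3) by blast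
  have "Poly_Mapping.lookup b \<le> Poly_Mapping.lookup m" by (rule le_funI) (simp add: ab(1) lookup_add)
  then show ?thesis using downsetD[OF assms(1)] assms(2)[OF ab(2)] by metis
qed

lemma keys_avoid_sum:
  assumes "\<And>i m. i \<in> S \<Longrightarrow> m \<in> Poly_Mapping.keys (p i) \<Longrightarrow> Poly_Mapping.lookup m \<notin> B"
    and "m \<in> Poly_Mapping.keys (sum p S)"
  shows "Poly_Mapping.lookup m \<notin> B"
proof -
  obtain i where "i \<in> S" "Poly_Mapping.lookup (p i) m \<noteq> 0"
    using assms(2) by (auto simp: in_keys_iff lookup_sum dest: sum.not_neutral_contains_not_neutral)
  then show ?thesis using assms(1) by (simp add: in_keys_iff)
qed

lemma lookup_mult_0:
  fixes p q :: "('v, 'k::comm_ring_1) mpol"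
  assumes "Poly_Mapping.lookup p 0 = 0"
  shows "Poly_Mapping.lookup (p * q) 0 = 0"
proof (rule ccontr)
  assume "\<not> ?thesis"
  then have "0 \<in> Poly_Mapping.keys (p * q)" by (simp add: in_keys_iff)
  then obtain a b where ab: "0 = a + b" "a \<in> Poly_Mapping.keys p" using keys_mult[of p q] by blast
  have "Poly_Mapping.lookup a v = 0" for v using arg_cong[OF ab(1), of "\<lambda>m. Poly_Mapping.lookup m v"] by (simp add: lookup_add)
  then have "a = 0" by (intro poly_mapping_eqI) simp
  then show False using ab(2) assms by (simp add: in_keys_iff)
qed

lemma lookup_kbd_0: "Poly_Mapping.lookup (kbd var c \<tau>) 0 = 0"
proof -
  have "Poly_Mapping.lookup (ksgn v \<tau> * var v * c (insert v \<tau>)) 0 = 0" for v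
    by (simp add: mult.assoc lookup_ksgn_mult lookup_var_mult)
  then show ?thesis by (simp add: kbd_def lookup_sum)
qed

definition hom_part :: "int \<Rightarrow> ('v::finite, 'k::comm_ring_1) mpol \<Rightarrow> ('v, 'k) mpol" where
  "hom_part d p = Abs_poly_mapping (\<lambda>m. if int (monom_deg m) = d then Poly_Mapping.lookup p m else 0)"

lemma lookup_hom_part:
  "Poly_Mapping.lookup (hom_part d p) m = (if int (monom_deg m) = d then Poly_Mapping.lookup p m else 0)"
proof -
  have "finite {m. (if int (monom_deg m) = d then Poly_Mapping.lookup p m else 0) \<noteq> 0}"
    by (rule finite_subset[OF _ finite_lookup[of p]]) auto
  then show ?thesis by (simp add: hom_part_def)
qed

lemma homogeneous_hom_part: "homogeneous d (hom_part d p)"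
  by (auto simp: homogeneous_def in_keys_iff lookup_hom_part split: if_splits)

lemma hom_part_homogeneous: "homogeneous d p \<Longrightarrow> hom_part d p = p"
  by (rule poly_mapping_eqI) (auto simp: homogeneous_def in_keys_iff lookup_hom_part)

lemma hom_part_sum: "hom_part d (sum p S) = (\<Sum>i\<in>S. hom_part d (p i))"
  by (rule poly_mapping_eqI) (simp add: lookup_hom_part lookup_sum)

lemma hom_part_mult:
  assumes "homogeneous e a"
  shows "hom_part (e + d) (a * p) = a * hom_part d p"
proof -
  have "hom_part (e + d) (a * (p - hom_part d p)) = 0"
  proof (rule poly_mapping_eqI)
    fix m
    have "m \<notin> Poly_Mapping.keys (a * (p - hom_part d p))" if "int (monom_deg m) = e + d"
    proof
      assume "m \<in> Poly_Mapping.keys (a * (p - hom_part d p))"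
      then obtain k l where kl: "m = k + l" "k \<in> Poly_Mapping.keys a" "l \<in> Poly_Mapping.keys (p - hom_part d p)"
        using keys_mult[of a "p - hom_part d p"] by blast
      have "int (monom_deg k) = e" using assms kl(2) by (simp add: homogeneous_def)
      moreover have "int (monom_deg l) \<noteq> d" using kl(3) by (auto simp: in_keys_iff lookup_minus lookup_hom_part split: if_splits)
      ultimately show False using that kl(1) by (simp add: monom_deg_add)
    qed
    then show "Poly_Mapping.lookup (hom_part (e + d) (a * (p - hom_part d p))) m = Poly_Mapping.lookup 0 m"
      by (auto simp: lookup_hom_part in_keys_iff)
  qed
  moreover have "hom_part (e + d) (a * p) - hom_part (e + d) (a * hom_part d p) = hom_part (e + d) (a * (p - hom_part d p))"
    by (rule poly_mapping_eqI) (simp add: lookup_hom_part lookup_minus right_diff_distrib)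
  ultimately have "hom_part (e + d) (a * p) = hom_part (e + d) (a * hom_part d p)" by simp
  also have "\<dots> = a * hom_part d p"
    by (rule hom_part_homogeneous[OF homogeneous_mult[OF assms homogeneous_hom_part]])
  finally show ?thesis .
qed

text \<open>
The double complex of a minimal free resolution of \<open>J\<close>, augmented by \<open>J\<close> at level \<open>0\<close>, and the Koszul
complex. By minimality a basis element of degree \<open>j\<close> in \<open>F\<^sub>i\<close>, which sits at level \<open>i + 1\<close>, satisfies the
starting condition of the diagram chase. If the Koszul homology of \<open>J\<close> vanished in degree \<open>i\<close> and
internal degree \<open>j\<close>, the basis element would lie in the sum of the image of \<open>F\<^bsub>i+1\<^esub>\<close> and
\<open>\<mm> F\<^sub>i\<close>, hence in \<open>\<mm> F\<^sub>i\<close>, which is absurd. The matrices are given by their entries: \<open>M l r c\<close> is the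
entry of the map from level \<open>l + 1\<close> to level \<open>l\<close>.
\<close>

lemma koszul_acyclic_imp_no_generator:
  fixes M :: "nat \<Rightarrow> nat \<Rightarrow> nat \<Rightarrow> ('v::finite, 'k::comm_ring_1) mpol" and D :: "nat \<Rightarrow> int list"
    and B :: "('v \<Rightarrow> nat) set"
  assumes D0: "D 0 = [0]"
    and hom: "\<And>l r c. r < length (D l) \<Longrightarrow> c < length (D (Suc l)) \<Longrightarrow> homogeneous (D (Suc l) ! c - D l ! r) (M l r c)"
    and image: "{\<Sum>c<length (D 1). M 0 0 c * u c | u. True} = {p. \<forall>m\<in>Poly_Mapping.keys p. Poly_Mapping.lookup m \<notin> B}"
    and MM: "\<And>l r w. r < length (D l) \<Longrightarrow>
      (\<Sum>c<length (D (Suc l)). M l r c * (\<Sum>c'<length (D (Suc (Suc l))). M (Suc l) c c' * w c')) = 0"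
    and exact: "\<And>l u. \<forall>r<length (D l). (\<Sum>c<length (D (Suc l)). M l r c * u c) = 0 \<Longrightarrow>
      \<exists>w. \<forall>c<length (D (Suc l)). (\<Sum>c'<length (D (Suc (Suc l))). M (Suc l) c c' * w c') = u c"
    and minimal: "\<And>l r c. r < length (D (Suc l)) \<Longrightarrow> c < length (D (Suc (Suc l))) \<Longrightarrow> Poly_Mapping.lookup (M (Suc l) r c) 0 = 0"
    and B: "downset B" "0 \<in> B"
    and acyc: "\<And>\<alpha>. int (sum \<alpha> UNIV) = j \<Longrightarrow> acyclic_at TYPE('k) B \<alpha> (Suc i)"
  shows "j \<notin> set (D (Suc i))"
proof
  assume "j \<in> set (D (Suc i))"
  then obtain r0 where r0: "r0 < length (D (Suc i))" "D (Suc i) ! r0 = j" by (auto simp: in_set_conv_nth)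
  define A :: "nat \<Rightarrow> nat \<Rightarrow> (nat \<Rightarrow> 'v set \<Rightarrow> ('v, 'k) mpol) set" where
    "A l q = {f. \<forall>r \<sigma>. (f r \<sigma> \<noteq> 0 \<longrightarrow> r < length (D l) \<and> card \<sigma> = q) \<and>
       (r < length (D l) \<longrightarrow> homogeneous (j - D l ! r - int q) (f r \<sigma>)) \<and>
       (l = 0 \<longrightarrow> (\<forall>m\<in>Poly_Mapping.keys (f r \<sigma>). Poly_Mapping.lookup m \<notin> B))}" for l q
  define d :: "nat \<Rightarrow> (nat \<Rightarrow> 'v set \<Rightarrow> ('v, 'k) mpol) \<Rightarrow> nat \<Rightarrow> 'v set \<Rightarrow> ('v, 'k) mpol" where
    "d l f r \<sigma> = (if r < length (D l) then \<Sum>c<length (D (Suc l)). M l r c * f c \<sigma> else 0)" for l f r \<sigma>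
  define e :: "(nat \<Rightarrow> 'v set \<Rightarrow> ('v, 'k) mpol) \<Rightarrow> nat \<Rightarrow> 'v set \<Rightarrow> ('v, 'k) mpol" where
    "e f r = kbd var (f r)" for f r
  have A_I: "f \<in> A l q"
    if "\<And>r \<sigma>. f r \<sigma> \<noteq> 0 \<Longrightarrow> r < length (D l) \<and> card \<sigma> = q"
      "\<And>r \<sigma>. r < length (D l) \<Longrightarrow> homogeneous (j - D l ! r - int q) (f r \<sigma>)"
      "\<And>r \<sigma> m. l = 0 \<Longrightarrow> m \<in> Poly_Mapping.keys (f r \<sigma>) \<Longrightarrow> Poly_Mapping.lookup m \<notin> B" for f l q
    using that unfolding A_def by blast
  have A1: "r < length (D l) \<and> card \<sigma> = q" if "f \<in> A l q" "f r \<sigma> \<noteq> 0" for f l q r \<sigma>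
    using that unfolding A_def by blast
  have A2: "homogeneous (j - D l ! r - int q) (f r \<sigma>)" if "f \<in> A l q" "r < length (D l)" for f l q r \<sigma>
    using that unfolding A_def by blast
  have A3: "Poly_Mapping.lookup m \<notin> B" if "f \<in> A 0 q" "m \<in> Poly_Mapping.keys (f r \<sigma>)" for f q r \<sigma> m
    using that unfolding A_def by blast
  have image_B: "Poly_Mapping.lookup m \<notin> B"
    if "m \<in> Poly_Mapping.keys (\<Sum>c<length (D 1). M 0 0 c * u c)" for m u
    using image that by blast
  have d_in: "d l x \<in> A l q" if x: "x \<in> A (Suc l) q" for x l q
  proof (rule A_I)
    show "r < length (D l) \<and> card \<sigma> = q" if "d l x r \<sigma> \<noteq> 0" for r \<sigma>
    proof -
      have r: "r < length (D l)" "(\<Sum>c<length (D (Suc l)). M l r c * x c \<sigma>) \<noteq> 0"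
        using that by (auto simp: d_def split: if_splits)
      obtain c where "M l r c * x c \<sigma> \<noteq> 0" using r(2) by (meson sum.not_neutral_contains_not_neutral)
      then have "x c \<sigma> \<noteq> 0" by auto
      then show ?thesis using A1[OF x] r(1) by blast
    qed
    show "homogeneous (j - D l ! r - int q) (d l x r \<sigma>)" if "r < length (D l)" for r \<sigma>
    proof -
      have "homogeneous (j - D l ! r - int q) (M l r c * x c \<sigma>)" if c: "c < length (D (Suc l))" for c
        using homogeneous_mult[OF hom[OF \<open>r < length (D l)\<close> c] A2[OF x c, of \<sigma>]] by (simp add: algebra_simps)
      then show ?thesis using that by (auto simp: d_def intro: homogeneous_sum)
    qed
    show "Poly_Mapping.lookup m \<notin> B" if "l = 0" "m \<in> Poly_Mapping.keys (d l x r \<sigma>)" for r \<sigma> m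
      using that image_B[of m "\<lambda>c. x c \<sigma>"] by (cases "r = 0") (auto simp: d_def D0)
  qed
  have e_in: "e x \<in> A l q" if x: "x \<in> A l (Suc q)" for x l q
  proof (rule A_I)
    show "r < length (D l) \<and> card \<sigma> = q" if nz: "e x r \<sigma> \<noteq> 0" for r \<sigma>
    proof -
      obtain v where "v \<notin> \<sigma>" "x r (insert v \<sigma>) \<noteq> 0" using nz unfolding e_def by (rule kbd_nonzeroE)
      then show ?thesis using A1[OF x, of r "insert v \<sigma>"] by simp
    qed
    show "homogeneous (j - D l ! r - int q) (e x r \<sigma>)" if "r < length (D l)" for r \<sigma>
      unfolding e_def by (rule homogeneous_kbd) (use A2[OF x that] in \<open>simp add: algebra_simps\<close>)
    show "Poly_Mapping.lookup m \<notin> B" if "l = 0" "m \<in> Poly_Mapping.keys (e x r \<sigma>)" for r \<sigma> m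
    proof (rule keys_avoid_sum)
      show "m \<in> Poly_Mapping.keys (\<Sum>v\<in>-\<sigma>. ksgn v \<sigma> * var v * x r (insert v \<sigma>))"
        using that(2) by (simp add: e_def kbd_def)
      show "Poly_Mapping.lookup n \<notin> B" if "n \<in> Poly_Mapping.keys (ksgn v \<sigma> * var v * x r (insert v \<sigma>))" for v n
        using A3[of x "Suc q"] x \<open>l = 0\<close> by (intro keys_avoid_mult[OF B(1) _ that]) simp
    qed
  qed
  have comm: "d l (e x) = e (d l x)" for l x
  proof (intro ext)
    fix r \<tau>
    show "d l (e x) r \<tau> = e (d l x) r \<tau>"
    proof (cases "r < length (D l)")
      case True
      have "d l (e x) r \<tau> = (\<Sum>c<length (D (Suc l)). \<Sum>v\<in>-\<tau>. M l r c * (ksgn v \<tau> * var v * x c (insert v \<tau>)))"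
        using True by (simp add: d_def e_def kbd_def sum_distrib_left)
      also have "\<dots> = (\<Sum>v\<in>-\<tau>. \<Sum>c<length (D (Suc l)). M l r c * (ksgn v \<tau> * var v * x c (insert v \<tau>)))"
        by (rule sum.swap)
      also have "\<dots> = e (d l x) r \<tau>"
        using True by (simp add: d_def e_def kbd_def sum_distrib_left mult_ac)
      finally show ?thesis .
    qed (simp add: d_def e_def kbd_def)
  qed
  have e_exact: "\<exists>y\<in>A l (Suc q). e y = z"
    if z: "z \<in> A l q" "e z = 0" and const: "\<And>r. Poly_Mapping.lookup (z r {}) 0 = 0" and l: "l = 0 \<Longrightarrow> q = i" for l q z
  proof -
    have "\<exists>b. (\<forall>\<sigma>. b \<sigma> \<noteq> 0 \<longrightarrow> r < length (D l) \<and> card \<sigma> = Suc q) \<and>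
        (r < length (D l) \<longrightarrow> (\<forall>\<sigma>. homogeneous (j - D l ! r - int (Suc q)) (b \<sigma>))) \<and>
        (l = 0 \<longrightarrow> (\<forall>\<sigma>. \<forall>m\<in>Poly_Mapping.keys (b \<sigma>). Poly_Mapping.lookup m \<notin> B)) \<and> kbd var b = z r" for r
    proof (cases "r < length (D l)")
      case False
      then have "z r = 0" using A1[OF z(1)] by (intro ext) auto
      then show ?thesis by (intro exI[of _ 0]) (auto simp: kbd_def fun_eq_iff)
    next
      case True
      define B' where "B' = (if l = 0 then B else {})"
      have B': "downset B'" "\<And>\<alpha>. int (sum \<alpha> UNIV) = j - D l ! r \<Longrightarrow> acyclic_at TYPE('k) B' \<alpha> (Suc q)"
        using B(1) acyc l True D0 by (auto simp: B'_def downset_def intro: acyclic_at_empty)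
      have "kbd var (z r) = 0" using fun_cong[OF z(2), of r] by (simp add: e_def)
      moreover have "Poly_Mapping.lookup m \<notin> B'" if "m \<in> Poly_Mapping.keys (z r \<sigma>)" for \<sigma> m
        using that z(1) A3[of z q] by (cases "l = 0") (simp_all add: B'_def)
      moreover have "z r \<sigma> \<noteq> 0 \<Longrightarrow> card \<sigma> = q" "homogeneous (j - D l ! r - int q) (z r \<sigma>)" for \<sigma>
        using A1[OF z(1)] A2[OF z(1) True] by blast+
      ultimately obtain b where "\<And>\<sigma>. b \<sigma> \<noteq> 0 \<Longrightarrow> card \<sigma> = Suc q" "\<And>\<sigma>. homogeneous (j - D l ! r - int (Suc q)) (b \<sigma>)"
        "\<And>\<sigma> m. m \<in> Poly_Mapping.keys (b \<sigma>) \<Longrightarrow> Poly_Mapping.lookup m \<notin> B'" "kbd var b = z r"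
        using kbd_poly_exact[of B' "j - D l ! r" q "z r"] B' const by blast
      then show ?thesis using True by (intro exI[of _ b]) (auto simp: B'_def)
    qed
    then obtain y where y: "\<And>r \<sigma>. y r \<sigma> \<noteq> 0 \<Longrightarrow> r < length (D l) \<and> card \<sigma> = Suc q"
        "\<And>r \<sigma>. r < length (D l) \<Longrightarrow> homogeneous (j - D l ! r - int (Suc q)) (y r \<sigma>)"
        "\<And>r \<sigma> m. l = 0 \<Longrightarrow> m \<in> Poly_Mapping.keys (y r \<sigma>) \<Longrightarrow> Poly_Mapping.lookup m \<notin> B"
        "\<And>r. kbd var (y r) = z r"
      by metis
    have "y \<in> A l (Suc q)" by (rule A_I) (use y in auto)
    moreover have "e y = z" by (rule ext) (simp add: e_def y(4))
    ultimately show ?thesis by blast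
  qed
  \<comment> \<open>A preimage can be replaced by its part of the right degree.\<close>
  have lift: "\<exists>y\<in>A (Suc l) q. d l y = z"
    if z: "z \<in> A l q" and w: "\<And>\<sigma>. \<exists>w. \<forall>r<length (D l). (\<Sum>c<length (D (Suc l)). M l r c * w c) = z r \<sigma>" for l q z
  proof -
    obtain w where w: "\<And>\<sigma> r. r < length (D l) \<Longrightarrow> (\<Sum>c<length (D (Suc l)). M l r c * w \<sigma> c) = z r \<sigma>"
      using w by metis
    define y where "y c \<sigma> = (if c < length (D (Suc l)) \<and> card \<sigma> = q then hom_part (j - D (Suc l) ! c - int q) (w \<sigma> c) else 0)" for c \<sigma>
    have "y \<in> A (Suc l) q" by (rule A_I) (auto simp: y_def homogeneous_hom_part split: if_splits)
    moreover have "d l y = z"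
    proof (intro ext)
      fix r \<sigma>
      show "d l y r \<sigma> = z r \<sigma>"
      proof (cases "r < length (D l) \<and> card \<sigma> = q")
        case True
        have "M l r c * hom_part (j - D (Suc l) ! c - int q) (w \<sigma> c) = hom_part (j - D l ! r - int q) (M l r c * w \<sigma> c)"
          if "c < length (D (Suc l))" for c
        proof -
          have "D (Suc l) ! c - D l ! r + (j - D (Suc l) ! c - int q) = j - D l ! r - int q" by simp
          then show ?thesis
            using hom_part_mult[OF hom[of r l c], of "j - D (Suc l) ! c - int q" "w \<sigma> c"] True that by metis
        qed
        then have "d l y r \<sigma> = (\<Sum>c<length (D (Suc l)). hom_part (j - D l ! r - int q) (M l r c * w \<sigma> c))"
          using True by (simp add: d_def y_def)
        also have "\<dots> = hom_part (j - D l ! r - int q) (z r \<sigma>)" using w True by (simp flip: hom_part_sum)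
        also have "\<dots> = z r \<sigma>" using A2[OF z] True by (intro hom_part_homogeneous) auto
        finally show ?thesis .
      next
        case False
        then have "z r \<sigma> = 0" using A1[OF z] by blast
        moreover have "d l y r \<sigma> = 0" using False by (auto simp: d_def y_def)
        ultimately show ?thesis by simp
      qed
    qed
    ultimately show ?thesis by blast
  qed
  define z0 where "z0 r \<sigma> = (if r = r0 \<and> \<sigma> = {} then 1 else 0 :: ('v, 'k) mpol)" for r and \<sigma> :: "'v set"
  have z0: "z0 \<in> A (Suc i) 0" by (rule A_I) (use r0 in \<open>auto simp: z0_def homogeneous_one split: if_splits\<close>)
  have "\<exists>y\<in>A (Suc (Suc i)) 0. \<exists>w\<in>A (Suc i) (Suc 0). z0 = d (Suc i) y + e w"
  proof (rule staircase[of A d "\<lambda>_. e"])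
    show "\<exists>y\<in>A 1 q. d 0 y = z" if z: "z \<in> A 0 q" for q z
    proof -
      have "\<exists>w. \<forall>r<length (D 0). (\<Sum>c<length (D (Suc 0)). M 0 r c * w c) = z r \<sigma>" for \<sigma>
      proof -
        have "z 0 \<sigma> \<in> {p. \<forall>m\<in>Poly_Mapping.keys p. Poly_Mapping.lookup m \<notin> B}" using A3[OF z] by blast
        then obtain u where "z 0 \<sigma> = (\<Sum>c<length (D 1). M 0 0 c * u c)" unfolding image[symmetric] by blast
        then show ?thesis by (auto simp: D0)
      qed
      then show ?thesis using lift[OF z] by simp
    qed
    show "\<exists>y\<in>A (Suc (Suc l)) q. d (Suc l) y = z" if z: "z \<in> A (Suc l) q" "d l z = 0" for l q z
    proof (rule lift[OF z(1)])
      fix \<sigma>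
      have "\<forall>r<length (D l). (\<Sum>c<length (D (Suc l)). M l r c * z c \<sigma>) = 0"
      proof (intro allI impI)
        fix r assume "r < length (D l)"
        then show "(\<Sum>c<length (D (Suc l)). M l r c * z c \<sigma>) = 0"
          using fun_cong[OF fun_cong[OF z(2), of r], of \<sigma>] by (simp add: d_def)
      qed
      then show "\<exists>w. \<forall>r<length (D (Suc l)). (\<Sum>c<length (D (Suc (Suc l))). M (Suc l) r c * w c) = z r \<sigma>"
        by (rule exact)
    qed
    show "\<exists>y\<in>A l (Suc (Suc q)). e y = z"
      if "Suc (Suc l) \<le> Suc i" "Suc l + Suc q = Suc i + 0" "z \<in> A l (Suc q)" "e z = 0" for l q z
    proof (rule e_exact[OF that(3,4)])
      show "Poly_Mapping.lookup (z r {}) 0 = 0" for r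
        using A1[OF that(3), of r "{}"] by (cases "z r {} = 0") auto
    qed (use that(2) in simp)
    show "\<exists>z'\<in>A l (Suc 0). d l z0 = e z'" if "Suc i = Suc l" for l
    proof -
      have li: "l = i" using that by simp
      have "d i z0 \<in> A i 0" by (rule d_in[OF z0])
      moreover have "e (d i z0) = 0"
        by (intro ext) (auto simp: e_def kbd_def d_def z0_def intro!: sum.neutral)
      moreover have "Poly_Mapping.lookup (d i z0 r {}) 0 = 0" for r
      proof (cases i)
        case 0
        show ?thesis
        proof (rule ccontr)
          assume "\<not> ?thesis"
          then have "0 \<in> Poly_Mapping.keys (d 0 z0 r {})" by (simp add: in_keys_iff 0)
          then have "Poly_Mapping.lookup (0 :: 'v \<Rightarrow>\<^sub>0 nat) \<notin> B" using A3 d_in[OF z0] 0 by blast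
          moreover have "Poly_Mapping.lookup (0 :: 'v \<Rightarrow>\<^sub>0 nat) = 0" by (rule ext) simp
          ultimately show False using B(2) by simp
        qed
      next
        case (Suc i')
        have "Poly_Mapping.lookup (M i r c * z0 c {}) 0 = 0" if "r < length (D i)" "c < length (D (Suc i))" for c
          by (rule lookup_mult_0) (use minimal[of r i' c] that Suc in simp)
        then show ?thesis by (simp add: d_def lookup_sum)
      qed
      ultimately have "\<exists>y\<in>A i (Suc 0). e y = d i z0" by (rule e_exact) auto
      then show ?thesis using li by metis
    qed
    show "x - y \<in> A l q" if xy: "x \<in> A l q" "y \<in> A l q" for l q x y
    proof (rule A_I)
      fix r \<sigma>
      show "r < length (D l) \<and> card \<sigma> = q" if "(x - y) r \<sigma> \<noteq> 0"
        using A1[OF xy(1), of r \<sigma>] A1[OF xy(2), of r \<sigma>] that by (cases "x r \<sigma> = 0") auto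
      show "homogeneous (j - D l ! r - int q) ((x - y) r \<sigma>)" if "r < length (D l)"
        using A2[OF xy(1) that] A2[OF xy(2) that] by (simp add: homogeneous_minus)
      show "Poly_Mapping.lookup m \<notin> B" if "l = 0" "m \<in> Poly_Mapping.keys ((x - y) r \<sigma>)" for m
        using keys_diff[of "x r \<sigma>" "y r \<sigma>"] that A3 xy by auto
    qed
    show "d l (x - y) = d l x - d l y" for l x y
      by (intro ext) (simp add: d_def right_diff_distrib sum_subtractf)
    show "e (x - y) = e x - e y" for x y by (intro ext) (simp add: e_def kbd_diff)
    show "d l (d (Suc l) x) = 0" for l x
      by (intro ext) (auto simp: d_def MM)
    show "e (e x) = 0" for x by (intro ext) (simp add: e_def[of "e x"], simp add: e_def kbd_kbd)
    show "0 \<in> A l q" for l q by (rule A_I) auto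
  qed (use d_in e_in comm z0 in auto)
  then obtain y w where yw: "z0 = d (Suc i) y + e w" by blast
  have "1 = Poly_Mapping.lookup (z0 r0 {}) 0" by (simp add: z0_def)
  also have "\<dots> = (\<Sum>c<length (D (Suc (Suc i))). Poly_Mapping.lookup (M (Suc i) r0 c * y c {}) 0) + Poly_Mapping.lookup (kbd var (w r0) {}) 0"
    using r0(1) by (simp add: yw d_def e_def lookup_add lookup_sum)
  also have "\<dots> = (0 :: 'k)"
    using r0(1) by (simp add: lookup_kbd_0 lookup_mult_0 minimal)
  finally show False by simp
qed

section \<open>Powers of edge ideals as monomial ideals\<close>

interpretation mult_module: Modules.module "(*) :: 'a::comm_ring_1 \<Rightarrow> 'a \<Rightarrow> 'a"
  by unfold_locales (auto simp: algebra_simps)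

definition monomial_ideal :: "('v \<Rightarrow>\<^sub>0 nat) set \<Rightarrow> ('v, 'k::comm_ring_1) mpol set" where
  "monomial_ideal U = {p. Poly_Mapping.keys p \<subseteq> U}"

definition add_closed :: "('v \<Rightarrow>\<^sub>0 nat) set \<Rightarrow> bool" where
  "add_closed U \<longleftrightarrow> (\<forall>m n. n \<in> U \<longrightarrow> m + n \<in> U)"

lemma subspace_monomial_ideal:
  assumes "add_closed U" shows "mult_module.subspace (monomial_ideal U :: ('v, 'k::comm_ring_1) mpol set)"
proof (rule mult_module.subspaceI)
  fix p q :: "('v, 'k) mpol"
  assume "p \<in> monomial_ideal U" "q \<in> monomial_ideal U"
  then show "p + q \<in> monomial_ideal U" using Poly_Mapping.keys_add[of p q] by (auto simp: monomial_ideal_def)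
next
  fix c p :: "('v, 'k) mpol"
  assume p: "p \<in> monomial_ideal U"
  show "c * p \<in> monomial_ideal U"
  proof -
    have "m \<in> U" if m: "m \<in> Poly_Mapping.keys (c * p)" for m
    proof -
      obtain a b where "m = a + b" "b \<in> Poly_Mapping.keys p" using keys_mult[of c p] m by blast
      then show ?thesis using assms p by (auto simp: add_closed_def monomial_ideal_def)
    qed
    then show ?thesis by (auto simp: monomial_ideal_def)
  qed
qed (simp add: monomial_ideal_def)

lemma monomial_decomposition:
  "(p :: ('v, 'k::comm_ring_1) mpol) = (\<Sum>m\<in>Poly_Mapping.keys p. Poly_Mapping.single m (Poly_Mapping.lookup p m))"
  by (rule poly_mapping_eqI) (auto simp: lookup_sum lookup_single when_def in_keys_iff)

lemma span_eq_monomial_ideal: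
  assumes "add_closed U" and "S \<subseteq> (monomial_ideal U :: ('v, 'k::comm_ring_1) mpol set)"
    and "\<And>m c. m \<in> U \<Longrightarrow> Poly_Mapping.single m c \<in> mult_module.span S"
  shows "mult_module.span S = monomial_ideal U"
proof
  show "mult_module.span S \<subseteq> monomial_ideal U"
    by (rule mult_module.span_minimal[OF assms(2) subspace_monomial_ideal[OF assms(1)]])
  show "monomial_ideal U \<subseteq> mult_module.span S"
  proof
    fix p :: "('v, 'k) mpol" assume "p \<in> monomial_ideal U"
    then show "p \<in> mult_module.span S"
      by (subst monomial_decomposition) (intro mult_module.span_sum assms(3), auto simp: monomial_ideal_def)
  qed
qed

definition edge_exponents :: "'v set set \<Rightarrow> ('v \<Rightarrow>\<^sub>0 nat) set" where
  "edge_exponents E = {Poly_Mapping.single u 1 + Poly_Mapping.single v 1 + m | u v m. {u, v} \<in> E}"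

primrec power_exponents :: "'v set set \<Rightarrow> nat \<Rightarrow> ('v \<Rightarrow>\<^sub>0 nat) set" where
  "power_exponents E 0 = UNIV"
| "power_exponents E (Suc s) = {m + n | m n. m \<in> edge_exponents E \<and> n \<in> power_exponents E s}"

lemma add_closed_edge_exponents: "add_closed (edge_exponents E)"
  unfolding add_closed_def edge_exponents_def by clarsimp (metis add.left_commute)

lemma add_closed_power_exponents: "add_closed (power_exponents E s)"
proof (induction s)
  case (Suc s)
  show ?case unfolding add_closed_def
  proof (intro allI impI)
    fix k x assume "x \<in> power_exponents E (Suc s)"
    then obtain m n where "x = m + n" "m \<in> edge_exponents E" "n \<in> power_exponents E s" by auto
    then have "k + x = (k + m) + n" "k + m \<in> edge_exponents E"
      using add_closed_edge_exponents[of E] by (auto simp: add_closed_def add.assoc)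
    then show "k + x \<in> power_exponents E (Suc s)" using \<open>n \<in> power_exponents E s\<close> by auto
  qed
qed (simp add: add_closed_def)

lemma edge_ideal_eq: "edge_ideal E = (monomial_ideal (edge_exponents E) :: ('v, 'k::comm_ring_1) mpol set)"
  unfolding edge_ideal_def
proof (rule span_eq_monomial_ideal[OF add_closed_edge_exponents])
  show "{var u * var v | u v. {u, v} \<in> E} \<subseteq> (monomial_ideal (edge_exponents E) :: ('v, 'k) mpol set)"
  proof -
    have "Poly_Mapping.single u 1 + Poly_Mapping.single v 1 \<in> edge_exponents E" if "{u, v} \<in> E" for u v
      unfolding edge_exponents_def using that by (intro CollectI exI[of _ u] exI[of _ v] exI[of _ 0]) simp
    then show ?thesis by (auto simp: monomial_ideal_def var_def mult_single)
  qed
  fix m and c :: 'k assume "m \<in> edge_exponents E"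
  then obtain u v n where m: "m = Poly_Mapping.single u 1 + Poly_Mapping.single v 1 + n" "{u, v} \<in> E"
    by (auto simp: edge_exponents_def)
  have "var u * var v \<in> mult_module.span {var u * var v :: ('v, 'k) mpol | u v. {u, v} \<in> E}"
    using m(2) by (intro mult_module.span_base) blast
  then have "Poly_Mapping.single n c * (var u * var v) \<in> mult_module.span {var u * var v | u v. {u, v} \<in> E}"
    by (rule mult_module.span_scale)
  moreover have "Poly_Mapping.single n c * (var u * var v) = Poly_Mapping.single m c"
    by (simp add: m(1) var_def mult_single add.commute)
  ultimately show "Poly_Mapping.single m c \<in> mult_module.span {var u * var v | u v. {u, v} \<in> E}" by simp
qed

lemma ideal_power_eq:
  "ideal_power (edge_ideal E) s = (monomial_ideal (power_exponents E s) :: ('v, 'k::comm_ring_1) mpol set)"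
proof (induction s)
  case (Suc s)
  let ?S = "{a * b | a b. a \<in> edge_ideal E \<and> b \<in> ideal_power (edge_ideal E) s} :: ('v, 'k) mpol set"
  have S: "?S = {a * b | a b. a \<in> monomial_ideal (edge_exponents E) \<and> b \<in> monomial_ideal (power_exponents E s)}"
    unfolding Suc unfolding edge_ideal_eq ..
  have "mult_module.span ?S = monomial_ideal (power_exponents E (Suc s))"
  proof (rule span_eq_monomial_ideal[OF add_closed_power_exponents])
    show "?S \<subseteq> monomial_ideal (power_exponents E (Suc s))"
    proof
      fix x assume "x \<in> ?S"
      then have "x \<in> {a * b | a b. a \<in> monomial_ideal (edge_exponents E) \<and> b \<in> monomial_ideal (power_exponents E s)}"
        by (simp only: S)
      then obtain a b where ab: "x = a * b" "Poly_Mapping.keys a \<subseteq> edge_exponents E" "Poly_Mapping.keys b \<subseteq> power_exponents E s"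
        by (auto simp: monomial_ideal_def)
      then show "x \<in> monomial_ideal (power_exponents E (Suc s))"
        using keys_mult[of a b] by (auto simp: monomial_ideal_def) blast
    qed
    fix k and c :: 'k assume "k \<in> power_exponents E (Suc s)"
    then obtain m n where mn: "k = m + n" "m \<in> edge_exponents E" "n \<in> power_exponents E s" by auto
    have "Poly_Mapping.single m c \<in> monomial_ideal (edge_exponents E)" "Poly_Mapping.single n (1 :: 'k) \<in> monomial_ideal (power_exponents E s)"
      using mn by (auto simp: monomial_ideal_def)
    moreover have "Poly_Mapping.single k c = Poly_Mapping.single m c * Poly_Mapping.single n 1"
      by (simp add: mn(1) mult_single)
    ultimately show "Poly_Mapping.single k c \<in> mult_module.span ?S"
      unfolding S by (intro mult_module.span_base) blast
  qed
  then show ?case by simp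
qed (simp add: monomial_ideal_def)

section \<open>Powers of the edge ideal and vertex covers\<close>

text \<open>
For a bipartite graph and a subset \<open>T\<close> of \<open>X\<close>, this is the smallest vertex cover with part \<open>T\<close> in \<open>X\<close>.
\<close>

definition cover_of :: "'v set set \<Rightarrow> 'v set \<Rightarrow> 'v set \<Rightarrow> 'v set" where
  "cover_of E X T = T \<union> {y. \<exists>x\<in>X - T. {x, y} \<in> E}"

definition vertex_cover :: "'v set set \<Rightarrow> 'v set \<Rightarrow> bool" where
  "vertex_cover E C \<longleftrightarrow> (\<forall>e\<in>E. e \<inter> C \<noteq> {})"

lemma bipartition_sym: "bipartition E X Y \<Longrightarrow> bipartition E Y X"
  unfolding bipartition_def by (metis Int_commute Un_commute insert_commute)

lemma bipartition_edge:
  assumes "bipartition E X Y" "{u, v} \<in> E"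
  shows "u \<in> X \<and> v \<in> Y \<or> u \<in> Y \<and> v \<in> X"
  using assms unfolding bipartition_def by (metis doubleton_eq_iff)

lemma vertex_cover_iff:
  assumes "bipartition E X Y"
  shows "vertex_cover E C \<longleftrightarrow> (\<forall>x\<in>X. \<forall>y\<in>Y. {x, y} \<in> E \<longrightarrow> x \<in> C \<or> y \<in> C)" (is "_ \<longleftrightarrow> ?r")
proof
  show "vertex_cover E C \<Longrightarrow> ?r" by (auto simp: vertex_cover_def)
  assume r: ?r
  show "vertex_cover E C"
    unfolding vertex_cover_def
  proof
    fix e assume e: "e \<in> E"
    have "\<exists>x\<in>X. \<exists>y\<in>Y. e = {x, y}" using assms e by (simp add: bipartition_def)
    then obtain x y where "x \<in> X" "y \<in> Y" "e = {x, y}" by (elim bexE)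
    then show "e \<inter> C \<noteq> {}" using r e by auto
  qed
qed

text \<open>
Among the covers of least weight that contain \<open>y\<close> let \<open>D\<close> have the largest part in \<open>X\<close>. Some neighbour
\<open>x\<close> of \<open>y\<close> of positive weight lies outside \<open>D\<close>, since otherwise \<open>y\<close> could be exchanged for its
neighbours of weight zero. As \<open>D\<close> dominates all covers of least weight through \<open>y\<close>, none of them contains
both \<open>x\<close> and \<open>y\<close>.
\<close>

lemma cover_exchange:
  fixes a :: "'v::finite \<Rightarrow> nat"
  assumes bip: "bipartition E X Y"
    and cov: "\<And>C. vertex_cover E C \<Longrightarrow> t \<le> sum a C"
    and C: "vertex_cover E C" "sum a C = t" "y \<in> C" "y \<in> Y" "0 < a y"
  obtains x where "{x, y} \<in> E" "0 < a x" "\<And>C'. vertex_cover E C' \<Longrightarrow> sum a C' = t \<Longrightarrow> \<not> (x \<in> C' \<and> y \<in> C')"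
proof -
  have XY: "X \<inter> Y = {}" "X \<union> Y = UNIV" using bip by (auto simp: bipartition_def)
  let ?P = "\<lambda>C. vertex_cover E C \<and> sum a C = t \<and> y \<in> C"
  have "\<exists>D. ?P D \<and> (\<forall>D'. ?P D' \<longrightarrow> card (D' \<inter> X) \<le> card (D \<inter> X))"
  proof (rule Lattices_Big.ex_has_greatest_nat[of ?P C "\<lambda>C. card (C \<inter> X)" "Suc (card X)"])
    show "?P C" using C by simp
    show "\<forall>D. ?P D \<longrightarrow> card (D \<inter> X) < Suc (card X)" by (simp add: less_Suc_eq_le card_mono)
  qed
  then obtain D where D: "?P D" and Dmax: "\<And>D'. ?P D' \<Longrightarrow> card (D' \<inter> X) \<le> card (D \<inter> X)" by blast
  \<comment> \<open>The minimum covers containing \<open>y\<close> are closed under joins, so \<open>D\<close> is the largest of them.\<close>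
  have le: "D' \<inter> X \<subseteq> D" if D': "?P D'" for D'
  proof -
    let ?J = "((D \<union> D') \<inter> X) \<union> ((D \<inter> D') \<inter> Y)" and ?M = "((D \<inter> D') \<inter> X) \<union> ((D \<union> D') \<inter> Y)"
    have "vertex_cover E ?J" "vertex_cover E ?M"
      using D D' XY unfolding vertex_cover_iff[OF bip] by auto
    moreover have "sum a ?J + sum a ?M = sum a D + sum a D'"
    proof -
      have "?J \<union> ?M = D \<union> D'" "?J \<inter> ?M = D \<inter> D'" using XY by auto
      then show ?thesis using sum.union_inter[of ?J ?M a] sum.union_inter[of D D' a] by simp
    qed
    moreover have "t \<le> sum a ?J" "t \<le> sum a ?M" using cov[of ?J] cov[of ?M] \<open>vertex_cover E ?J\<close> \<open>vertex_cover E ?M\<close> by simp_all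
    ultimately have "sum a ?J = t" using D D' by linarith
    then have "card (?J \<inter> X) \<le> card (D \<inter> X)" using Dmax[of ?J] \<open>vertex_cover E ?J\<close> D D' \<open>y \<in> Y\<close> by auto
    moreover have "D \<inter> X \<subseteq> ?J \<inter> X" by auto
    ultimately have "?J \<inter> X = D \<inter> X" by (metis card_seteq finite)
    then show ?thesis by auto
  qed
  have "\<exists>x. {x, y} \<in> E \<and> 0 < a x \<and> x \<notin> D"
  proof (rule ccontr)
    assume none: "\<not> ?thesis"
    let ?D = "(D - {y}) \<union> {x. {x, y} \<in> E}"
    have "vertex_cover E ?D"
      unfolding vertex_cover_iff[OF bip]
    proof (intro ballI impI)
      fix u v assume uv: "u \<in> X" "v \<in> Y" "{u, v} \<in> E"
      then have "u \<noteq> y" "u \<in> D \<or> v \<in> D" using XY \<open>y \<in> Y\<close> D by (auto simp: vertex_cover_iff[OF bip])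
      then show "u \<in> ?D \<or> v \<in> ?D" using uv(3) by (cases "v = y") auto
    qed
    then have "t \<le> sum a ?D" by (rule cov)
    also have "sum a ?D = sum a (D - {y})"
    proof (rule sum.mono_neutral_right)
      have "{y, y} \<notin> E" using bipartition_edge[OF bip, of y y] XY by auto
      then show "\<forall>x\<in>?D - (D - {y}). a x = 0" using none by auto
    qed auto
    also have "\<dots> = t - a y" using D by (simp add: sum_diff1_nat)
    finally have "t \<le> t - a y" .
    moreover have "a y \<le> t" using D member_le_sum[of y D a] by auto
    ultimately show False using \<open>0 < a y\<close> by simp
  qed
  then obtain x where x: "{x, y} \<in> E" "0 < a x" "x \<notin> D" by blast
  have "x \<in> X" using bipartition_edge[OF bip x(1)] XY \<open>y \<in> Y\<close> by auto
  then have "\<not> (x \<in> C' \<and> y \<in> C')" if "vertex_cover E C'" "sum a C' = t" for C'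
    using le[of C'] that x(3) by auto
  then show ?thesis using that x by blast
qed

text \<open>
The edge that can be removed in the induction: subtracting it from \<open>a\<close> lowers the weight of every tight
cover by one only.
\<close>

lemma tight_edge:
  fixes a :: "'v::finite \<Rightarrow> nat"
  assumes bip: "bipartition E X Y" and t: "0 < t"
    and cov: "\<And>C. vertex_cover E C \<Longrightarrow> t \<le> sum a C"
  obtains x y where "{x, y} \<in> E" "x \<noteq> y" "0 < a x" "0 < a y"
    "\<And>C. vertex_cover E C \<Longrightarrow> sum a C = t \<Longrightarrow> \<not> (x \<in> C \<and> y \<in> C)"
proof -
  have ne: "u \<noteq> v" if "{u, v} \<in> E" for u v
    using bipartition_edge[OF bip that] bip by (auto simp: bipartition_def)
  show ?thesis
  proof (cases "\<exists>C. vertex_cover E C \<and> sum a C = t")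
    case False
    have "\<exists>e\<in>E. \<forall>v\<in>e. 0 < a v"
    proof (rule ccontr)
      assume "\<not> ?thesis"
      then have "vertex_cover E {v. a v = 0}" by (auto simp: vertex_cover_def)
      then have "t \<le> sum a {v. a v = 0}" by (rule cov)
      then show False using t by simp
    qed
    then obtain x y where "{x, y} \<in> E" "0 < a x" "0 < a y"
      using bip by (fastforce simp: bipartition_def)
    then show ?thesis using that[of x y] False ne by blast
  next
    case True
    then obtain C where C: "vertex_cover E C" "sum a C = t" by blast
    then have "sum a C \<noteq> 0" using t by simp
    then obtain v where v: "v \<in> C" "0 < a v" by (auto elim: sum.not_neutral_contains_not_neutral)
    consider "v \<in> X" | "v \<in> Y" using bip by (auto simp: bipartition_def)
    then obtain x where "{x, v} \<in> E" "0 < a x" "\<And>C'. vertex_cover E C' \<Longrightarrow> sum a C' = t \<Longrightarrow> \<not> (x \<in> C' \<and> v \<in> C')"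
    proof cases
      case 1
      then show ?thesis using cover_exchange[OF bipartition_sym[OF bip] cov C v(1) _ v(2)] that by blast
    next
      case 2
      then show ?thesis using cover_exchange[OF bip cov C v(1) _ v(2)] that by blast
    qed
    then show ?thesis using that[of x v] v(2) ne by blast
  qed
qed

text \<open>
A weighted form of Koenig's theorem: the largest number of edges, with repetition, whose product
divides a monomial equals the least weight of a vertex cover. Algebraically, the ordinary and the
symbolic powers of the edge ideal of a bipartite graph agree.
\<close>

lemma power_exponents_iff_cover:
  fixes E :: "'v::finite set set"
  assumes bip: "bipartition E X Y"
  shows "m \<in> power_exponents E s \<longleftrightarrow> (\<forall>C. vertex_cover E C \<longrightarrow> s \<le> sum (Poly_Mapping.lookup m) C)"
proof
  show "m \<in> power_exponents E s \<Longrightarrow> \<forall>C. vertex_cover E C \<longrightarrow> s \<le> sum (Poly_Mapping.lookup m) C"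
  proof (induction s arbitrary: m)
    case (Suc s)
    then obtain u v k n where m: "m = (Poly_Mapping.single u 1 + Poly_Mapping.single v 1 + k) + n"
        "{u, v} \<in> E" "n \<in> power_exponents E s"
      by (auto simp: edge_exponents_def)
    show ?case
    proof (intro allI impI)
      fix C assume C: "vertex_cover E C"
      then have "1 \<le> sum (\<lambda>w. Poly_Mapping.lookup (Poly_Mapping.single u 1 + Poly_Mapping.single v (1::nat)) w) C"
        using m(2) by (auto simp: vertex_cover_def lookup_add lookup_single when_def sum.distrib)
      moreover have "s \<le> sum (Poly_Mapping.lookup n) C" using Suc.IH[OF m(3)] C by blast
      ultimately show "Suc s \<le> sum (Poly_Mapping.lookup m) C"
        by (simp add: m(1) lookup_add sum.distrib)
    qed
  qed simp
  show "\<forall>C. vertex_cover E C \<longrightarrow> s \<le> sum (Poly_Mapping.lookup m) C \<Longrightarrow> m \<in> power_exponents E s"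
  proof (induction s arbitrary: m)
    case (Suc s)
    obtain x y where xy: "{x, y} \<in> E" "x \<noteq> y" "0 < Poly_Mapping.lookup m x" "0 < Poly_Mapping.lookup m y"
      and tight: "\<And>C. vertex_cover E C \<Longrightarrow> sum (Poly_Mapping.lookup m) C = Suc s \<Longrightarrow> \<not> (x \<in> C \<and> y \<in> C)"
      using tight_edge[OF bip, of "Suc s" "Poly_Mapping.lookup m"] Suc.prems by blast
    let ?e = "Poly_Mapping.single x 1 + Poly_Mapping.single y (1::nat)"
    define n where "n = m - ?e"
    have m: "m = ?e + n"
      by (rule poly_mapping_eqI) (use xy in \<open>auto simp: n_def lookup_add lookup_minus lookup_single when_def\<close>)
    have "s \<le> sum (Poly_Mapping.lookup n) C" if C: "vertex_cover E C" for C
    proof -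
      have "sum (Poly_Mapping.lookup m) C = (if x \<in> C then 1 else 0) + (if y \<in> C then 1 else 0) + sum (Poly_Mapping.lookup n) C"
        by (simp add: m lookup_add sum.distrib lookup_single when_def)
      moreover have "Suc s \<le> sum (Poly_Mapping.lookup m) C" using Suc.prems C by blast
      moreover have "sum (Poly_Mapping.lookup m) C \<noteq> Suc s" if "x \<in> C" "y \<in> C" using tight[OF C] that by blast
      ultimately show ?thesis by (cases "x \<in> C"; cases "y \<in> C"; fastforce)
    qed
    then have "n \<in> power_exponents E s" using Suc.IH by blast
    moreover have "?e \<in> edge_exponents E"
      unfolding edge_exponents_def using xy(1) by (intro CollectI exI[of _ x] exI[of _ y] exI[of _ 0]) simp
    ultimately show ?case using m by auto
  qed simp
qed

section \<open>Minimal vertex covers of a bipartite graph\<close>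

text \<open>
The parts in \<open>X\<close> of the minimal vertex covers: minimality means that every \<open>x\<close> in \<open>T\<close> has an edge
\<open>xy\<close> that no other vertex of the cover meets, and \<open>y\<close> is outside the cover iff all its neighbours
are in \<open>T\<close>.
\<close>

definition cover_parts :: "'v set set \<Rightarrow> 'v set \<Rightarrow> 'v set set" where
  "cover_parts E X = {T. T \<subseteq> X \<and> (\<forall>x\<in>T. \<exists>y. {x, y} \<in> E \<and> (\<forall>x'. {x', y} \<in> E \<longrightarrow> x' \<in> T))}"

lemma cover_parts_Un: "T \<in> cover_parts E X \<Longrightarrow> T' \<in> cover_parts E X \<Longrightarrow> T \<union> T' \<in> cover_parts E X"
  unfolding cover_parts_def by (simp add: Ball_def) (metis UnE)

lemma in_cover_of: "z \<in> cover_of E X T \<longleftrightarrow> z \<in> T \<or> (\<exists>x\<in>X - T. {x, z} \<in> E)"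
  by (simp add: cover_of_def)

lemma vertex_cover_cover_of:
  assumes "bipartition E X Y" shows "vertex_cover E (cover_of E X T)"
  unfolding vertex_cover_iff[OF assms] in_cover_of by blast

text \<open>
Discarding the superfluous vertices of \<open>T\<close> in one step is enough: the neighbours of a discarded vertex
are already in the cover.
\<close>

lemma ex_cover_part_below:
  assumes bip: "bipartition E X Y" and "T \<subseteq> X"
  obtains T' where "T' \<in> cover_parts E X" "cover_of E X T' \<subseteq> cover_of E X T"
proof
  let ?T = "{x\<in>T. \<exists>y. {x, y} \<in> E \<and> (\<forall>x'. {x', y} \<in> E \<longrightarrow> x' \<in> T)}"
  show "?T \<in> cover_parts E X" using \<open>T \<subseteq> X\<close> by (auto simp: cover_parts_def)
  show "cover_of E X ?T \<subseteq> cover_of E X T"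
  proof
    fix z assume "z \<in> cover_of E X ?T"
    then consider "z \<in> T" | x where "x \<in> X" "x \<notin> ?T" "{x, z} \<in> E" unfolding in_cover_of by blast
    then show "z \<in> cover_of E X T"
    proof cases
      case 2
      show ?thesis
      proof (cases "x \<in> T")
        case True
        then obtain x' where x': "{x', z} \<in> E" "x' \<notin> T" using 2 by blast
        have "x' \<in> X" using bipartition_edge[OF bip x'(1)] bipartition_edge[OF bip 2(3)] 2(1) bip
          by (auto simp: bipartition_def)
        then show ?thesis using x' by (auto simp: in_cover_of)
      qed (use 2 in \<open>auto simp: in_cover_of\<close>)
    qed (simp add: in_cover_of)
  qed
qed

text \<open>
For \<open>T\<close> and \<open>T'\<close> the parts of two covers in \<open>X\<close>, the neighbours of \<open>X - (T \<inter> T')\<close> are the union of the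
two sets of neighbours, whereas those of \<open>X - (T \<union> T')\<close> only lie in the intersection.
\<close>

lemma cover_of_submodular:
  fixes a :: "'v::finite \<Rightarrow> nat"
  assumes bip: "bipartition E X Y" and T: "T \<subseteq> X" "T' \<subseteq> X"
  shows "sum a (cover_of E X (T \<union> T')) + sum a (cover_of E X (T \<inter> T')) \<le> sum a (cover_of E X T) + sum a (cover_of E X T')"
proof -
  let ?c = "cover_of E X"
  have no: "\<not> (\<exists>x\<in>X - S. {x, z} \<in> E)" if "z \<in> X" for z S
    using bipartition_edge[OF bip] bip that by (auto simp: bipartition_def)
  have sub: "?c (T \<union> T') \<union> ?c (T \<inter> T') \<subseteq> ?c T \<union> ?c T'" "?c (T \<union> T') \<inter> ?c (T \<inter> T') \<subseteq> ?c T \<inter> ?c T'"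
  proof -
    show "?c (T \<union> T') \<union> ?c (T \<inter> T') \<subseteq> ?c T \<union> ?c T'" by (auto simp: in_cover_of)
    show "?c (T \<union> T') \<inter> ?c (T \<inter> T') \<subseteq> ?c T \<inter> ?c T'"
    proof
      fix z assume z: "z \<in> ?c (T \<union> T') \<inter> ?c (T \<inter> T')"
      show "z \<in> ?c T \<inter> ?c T'"
      proof (cases "z \<in> X")
        case True
        then show ?thesis using z no[OF True] by (auto simp: in_cover_of)
      next
        case False
        then show ?thesis using z T by (auto simp: in_cover_of)
      qed
    qed
  qed
  have "sum a (?c (T \<union> T')) + sum a (?c (T \<inter> T')) = sum a (?c (T \<union> T') \<union> ?c (T \<inter> T')) + sum a (?c (T \<union> T') \<inter> ?c (T \<inter> T'))"
    by (simp add: sum.union_inter)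
  also have "\<dots> \<le> sum a (?c T \<union> ?c T') + sum a (?c T \<inter> ?c T')"
    by (intro add_mono sum_mono2 sub) auto
  also have "\<dots> = sum a (?c T) + sum a (?c T')" by (simp add: sum.union_inter)
  finally show ?thesis .
qed

text \<open>
Each step \<open>T \<subset> T'\<close> contributes an edge \<open>xy\<close> with \<open>x\<close> in \<open>T' - T\<close> and all neighbours of \<open>y\<close> in \<open>T'\<close>. The
edges of the later steps have their end in \<open>X\<close> outside \<open>T'\<close>, so they avoid \<open>x\<close> and cannot end in \<open>y\<close>.
\<close>

lemma cover_parts_chain_matching:
  fixes E :: "'v::finite set set"
  assumes bip: "bipartition E X Y"
    and "sorted_wrt (\<subset>) (T # D)" "set (T # D) \<subseteq> cover_parts E X"
  shows "\<exists>M. matching E M \<and> card M = length D \<and> (\<forall>e\<in>M. e \<inter> T = {})"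
  using assms(2,3)
proof (induction D arbitrary: T)
  case Nil
  show ?case by (intro exI[of _ "{}"]) (simp add: matching_def)
next
  case (Cons T' D)
  have "T \<subset> T'" and ess: "T' \<in> cover_parts E X" using Cons.prems by auto
  have "\<exists>M. matching E M \<and> card M = length D \<and> (\<forall>e\<in>M. e \<inter> T' = {})"
    by (rule Cons.IH) (use Cons.prems in auto)
  then obtain M where M: "matching E M" "card M = length D" "\<And>e. e \<in> M \<Longrightarrow> e \<inter> T' = {}" by blast
  obtain x where x: "x \<in> T'" "x \<notin> T" using \<open>T \<subset> T'\<close> by blast
  obtain y where y: "{x, y} \<in> E" "\<And>x'. {x', y} \<in> E \<Longrightarrow> x' \<in> T'"
    using ess x(1) unfolding cover_parts_def by blast
  have T'X: "T' \<subseteq> X" using ess by (simp add: cover_parts_def)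
  have "y \<in> Y" using bipartition_edge[OF bip y(1)] x(1) T'X bip by (auto simp: bipartition_def)
  have disj: "disjnt e {x, y}" if "e \<in> M" for e
  proof -
    have "e \<in> E" using that M(1) by (auto simp: matching_def)
    have "y \<notin> e"
    proof
      assume "y \<in> e"
      have "\<exists>u\<in>X. \<exists>v\<in>Y. e = {u, v}" using bip \<open>e \<in> E\<close> by (simp add: bipartition_def)
      then obtain u v where uv: "u \<in> X" "v \<in> Y" "e = {u, v}" by (elim bexE)
      have "v = y" using uv \<open>y \<in> e\<close> \<open>y \<in> Y\<close> bip by (auto simp: bipartition_def)
      then have "u \<in> T'" using y(2) uv(3) \<open>e \<in> E\<close> by blast
      then show False using M(3)[OF that] uv(3) by auto
    qed
    then show ?thesis using M(3)[OF that] x(1) by (auto simp: disjnt_def)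
  qed
  have "{x, y} \<notin> M" using disj[of "{x, y}"] by (auto simp: disjnt_def)
  moreover have "matching E (insert {x, y} M)"
    using M(1) y(1) disj by (auto simp: matching_def pairwise_insert disjnt_sym)
  moreover have "e \<inter> T = {}" if "e \<in> insert {x, y} M" for e
    using that M(3) \<open>T \<subset> T'\<close> x(2) \<open>y \<in> Y\<close> T'X bip by (auto simp: bipartition_def)
  moreover have "card (insert {x, y} M) = length (T' # D)"
    using M(2) \<open>{x, y} \<notin> M\<close> by simp
  ultimately show ?case by blast
qed

lemma cover_parts_chain_length:
  fixes E :: "'v::finite set set"
  assumes "bipartition E X Y" "sorted_wrt (\<subset>) D" "set D \<subseteq> cover_parts E X"
  shows "length D \<le> Suc (matching_number E)"
proof (cases D)
  case (Cons T D')
  then obtain M where "matching E M" "card M = length D'"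
    using cover_parts_chain_matching[OF assms(1), of T D'] assms by blast
  then have "length D' \<le> matching_number E"
    unfolding matching_number_def \<open>card M = length D'\<close>[symmetric] by (intro Max_ge) auto
  then show ?thesis using Cons by simp
qed simp

text \<open>
Exponents of the monomials outside the \<open>s\<close>-th power of the prime ideal of the cover.
\<close>

definition light :: "'v set set \<Rightarrow> 'v set \<Rightarrow> nat \<Rightarrow> 'v set \<Rightarrow> ('v \<Rightarrow> nat) set" where
  "light E X s T = {a. sum a (cover_of E X T) < s}"

lemma downset_light:
  fixes E :: "'v::finite set set"
  shows "downset (light E X s T)"
  unfolding downset_def light_def using sum_mono[of "cover_of E X T"]
  by (metis (no_types, lifting) le_funD mem_Collect_eq order_le_less_trans)

text \<open>
Let \<open>W\<close> be the union of the smallest and the largest cover of the chain; it contains the other covers. A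
variable outside \<open>W\<close> is free, so it must not occur in \<open>\<alpha>\<close> if there is to be homology. But a monomial
on \<open>W\<close> that is light for both of these covers has degree at most \<open>2(s - 1)\<close>, and
removing \<open>q\<close> variables from \<open>\<alpha>\<close> leaves more than that.
\<close>

lemma acyclic_at_light_chain:
  fixes E :: "'v::finite set set"
  assumes D: "D \<noteq> []" "sorted_wrt (\<subset>) D" and \<alpha>: "q + 2 * s \<le> sum \<alpha> UNIV + 1"
  shows "acyclic_at TYPE('k::comm_ring_1) (\<Inter>(light E X s ` set D)) \<alpha> q"
proof -
  let ?W = "cover_of E X (hd D) \<union> cover_of E X (last D)"
  have W: "cover_of E X T \<subseteq> ?W" if T: "T \<in> set D" for T
  proof -
    obtain n where n: "n < length D" "T = D ! n" using T by (auto simp: in_set_conv_nth)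
    have le: "D ! i \<subseteq> D ! j" if "i \<le> j" "j < length D" for i j
      using sorted_wrt_nth_less[OF D(2), of i j] that by (cases "i = j") auto
    have "hd D \<subseteq> T" "T \<subseteq> last D"
      using le[of 0 n] le[of n "length D - 1"] n D(1) by (simp_all add: hd_conv_nth last_conv_nth)
    then show ?thesis unfolding cover_of_def by blast
  qed
  show ?thesis
  proof (cases "\<exists>v. v \<notin> ?W \<and> 0 < \<alpha> v")
    case True
    then obtain v where v: "v \<notin> ?W" "0 < \<alpha> v" by blast
    show ?thesis
    proof (rule acyclic_at_cone[of _ v])
      fix a t assume a: "a \<in> \<Inter>(light E X s ` set D)"
      have "sum (a(v := t)) (cover_of E X T) = sum a (cover_of E X T)" if "T \<in> set D" for T
        by (rule sum.cong) (use v(1) W[OF that] in auto)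
      then show "a(v := t) \<in> \<Inter>(light E X s ` set D)" using a by (simp add: light_def)
    qed (rule v(2))
  next
    case False
    show ?thesis
    proof (rule acyclic_at_empty)
      fix \<sigma> assume \<sigma>: "card \<sigma> = q" "\<forall>v\<in>\<sigma>. 0 < \<alpha> v"
      show "esub \<alpha> \<sigma> \<notin> \<Inter>(light E X s ` set D)"
      proof
        assume "esub \<alpha> \<sigma> \<in> \<Inter>(light E X s ` set D)"
        then have light: "sum (esub \<alpha> \<sigma>) (cover_of E X T) < s" if "T \<in> set D" for T
          using that by (simp add: light_def)
        have "sum \<alpha> UNIV = sum (\<lambda>v. esub \<alpha> \<sigma> v + (if v \<in> \<sigma> then 1 else 0)) UNIV"
          by (rule sum.cong) (use \<sigma>(2) in \<open>auto simp: esub_def\<close>)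
        also have "\<dots> = sum (esub \<alpha> \<sigma>) UNIV + q"
          using \<sigma>(1) by (simp add: sum.distrib sum.If_cases)
        also have "sum (esub \<alpha> \<sigma>) UNIV = sum (esub \<alpha> \<sigma>) ?W"
          by (rule sum.mono_neutral_right) (use False in \<open>auto simp: esub_def\<close>)
        also have "\<dots> \<le> sum (esub \<alpha> \<sigma>) (cover_of E X (hd D)) + sum (esub \<alpha> \<sigma>) (cover_of E X (last D))"
          using sum.union_inter[of "cover_of E X (hd D)" "cover_of E X (last D)" "esub \<alpha> \<sigma>"] by simp
        finally show False using light[of "hd D"] light[of "last D"] D(1) \<alpha> by simp
      qed
    qed
  qed
qed

text \<open>
The cover part \<open>T0\<close> of least weight serves as the apex of all contractions at \<open>a\<close>. By submodularity
joining with it does not increase the weight, as the meet weighs at least as much as \<open>T0\<close>.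
\<close>

lemma acyclic_at_light_Union:
  fixes E :: "'v::finite set set"
  assumes bip: "bipartition E X Y" and \<alpha>: "p + matching_number E + 2 * s \<le> sum \<alpha> UNIV + 1"
  shows "acyclic_at TYPE('k::comm_ring_1) (\<Union>(light E X s ` cover_parts E X)) \<alpha> p"
proof (rule acyclic_at_Union[where k = "matching_number E"])
  show "downset (light E X s T)" for T by (rule downset_light)
  show "length D \<le> Suc (matching_number E)" if "sorted_wrt (\<subset>) D" "set D \<subseteq> cover_parts E X" for D
    by (rule cover_parts_chain_length[OF bip that])
  show "acyclic_at TYPE('k) (\<Inter>(light E X s ` set D)) \<alpha> q"
    if "D \<noteq> []" "sorted_wrt (\<subset>) D" "q \<le> p + matching_number E" for D q
    by (rule acyclic_at_light_chain) (use that \<alpha> in auto)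
  fix a :: "'v \<Rightarrow> nat" assume a: "a \<in> \<Union>(light E X s ` cover_parts E X)"
  let ?w = "\<lambda>T. sum a (cover_of E X T)"
  have "Min (?w ` Pow X) \<in> ?w ` Pow X" by (rule Min_in) auto
  then obtain T1 where T1: "T1 \<subseteq> X" "?w T1 = Min (?w ` Pow X)" by (elim imageE) simp
  obtain T0 where T0: "T0 \<in> cover_parts E X" "cover_of E X T0 \<subseteq> cover_of E X T1"
    using ex_cover_part_below[OF bip T1(1)] by blast
  have "?w T0 \<le> ?w T1" using T0(2) by (intro sum_mono2) auto
  then have min: "?w T0 \<le> ?w T" if "T \<subseteq> X" for T
  proof -
    have "Min (?w ` Pow X) \<le> ?w T" by (intro Min_le imageI) (use that in auto)
    then show ?thesis using \<open>?w T0 \<le> ?w T1\<close> T1(2) by simp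
  qed
  have "?w (T \<union> T0) \<le> ?w T" if "T \<in> cover_parts E X" for T
  proof -
    have "T \<subseteq> X" "T0 \<subseteq> X" using that T0(1) by (auto simp: cover_parts_def)
    moreover have "T \<inter> T0 \<subseteq> X" using \<open>T \<subseteq> X\<close> by blast
    ultimately show ?thesis using cover_of_submodular[OF bip, of T T0 a] min[of "T \<inter> T0"] by linarith
  qed
  moreover obtain T where T: "T \<in> cover_parts E X" "a \<in> light E X s T" using a by blast
  moreover have "a \<in> light E X s T0"
    using T min[of T] by (auto simp: light_def cover_parts_def)
  ultimately show "\<exists>T0\<in>cover_parts E X. a \<in> light E X s T0 \<and>
      (\<forall>T\<in>cover_parts E X. a \<in> light E X s T \<longrightarrow> T \<union> T0 \<in> cover_parts E X \<and> a \<in> light E X s (T \<union> T0))"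
    using T0(1) cover_parts_Un by (intro bexI[of _ T0]) (fastforce simp: light_def)+
qed

lemma power_exponents_eq_light:
  fixes E :: "'v::finite set set"
  assumes bip: "bipartition E X Y"
  shows "m \<in> power_exponents E s \<longleftrightarrow> Poly_Mapping.lookup m \<notin> \<Union>(light E X s ` cover_parts E X)"
proof -
  let ?a = "Poly_Mapping.lookup m"
  have eq: "(\<exists>C. vertex_cover E C \<and> sum ?a C < s) \<longleftrightarrow> (\<exists>T\<in>cover_parts E X. sum ?a (cover_of E X T) < s)"
  proof
    assume "\<exists>C. vertex_cover E C \<and> sum ?a C < s"
    then obtain C where C: "vertex_cover E C" "sum ?a C < s" by blast
    obtain T where T: "T \<in> cover_parts E X" "cover_of E X T \<subseteq> cover_of E X (C \<inter> X)"
      using ex_cover_part_below[OF bip, of "C \<inter> X"] by auto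
    have "cover_of E X (C \<inter> X) \<subseteq> C"
    proof
      fix z assume "z \<in> cover_of E X (C \<inter> X)"
      then show "z \<in> C" using C(1) by (auto simp: in_cover_of vertex_cover_def)
    qed
    then have "sum ?a (cover_of E X T) \<le> sum ?a C" using T(2) by (intro sum_mono2) auto
    then show "\<exists>T\<in>cover_parts E X. sum ?a (cover_of E X T) < s" using C(2) T(1) by (metis order_le_less_trans)
  next
    assume "\<exists>T\<in>cover_parts E X. sum ?a (cover_of E X T) < s"
    then show "\<exists>C. vertex_cover E C \<and> sum ?a C < s" using vertex_cover_cover_of[OF bip] by blast
  qed
  have "m \<in> power_exponents E s \<longleftrightarrow> \<not> (\<exists>C. vertex_cover E C \<and> sum ?a C < s)"
    unfolding power_exponents_iff_cover[OF bip] by (simp add: not_less)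
  also have "\<dots> \<longleftrightarrow> ?a \<notin> \<Union>(light E X s ` cover_parts E X)"
    unfolding eq by (simp add: light_def)
  finally show ?thesis .
qed

section \<open>The regularity bound\<close>

lemma scalar_prod_vec: "g \<in> carrier_vec n \<Longrightarrow> g \<bullet> vec n u = (\<Sum>c<n. g $ c * u c)"
  by (simp add: scalar_prod_def lessThan_atLeast0)

lemma mult_mat_vec_nth:
  assumes "A \<in> carrier_mat n m" "r < n"
  shows "(A *\<^sub>v vec m u) $ r = (\<Sum>c<m. A $$ (r, c) * u c)"
  using assms by (auto simp: scalar_prod_def lessThan_atLeast0 intro!: sum.cong)

lemma vec_nth: "v \<in> carrier_vec n \<Longrightarrow> vec n (\<lambda>i. v $ i) = v"
  by auto

text \<open>
The ideal itself becomes level \<open>0\<close>, with one generator of degree \<open>0\<close>, and \<open>F\<^sub>i\<close> becomes level \<open>i + 1\<close>.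
\<close>

lemma koszul_acyclic_imp_not_in_degrees:
  fixes I :: "('v::finite, 'k::field) mpol set" and B :: "('v \<Rightarrow> nat) set"
  assumes res: "minimal_graded_free_resolution I D g A"
    and I: "I = {p. \<forall>m\<in>Poly_Mapping.keys p. Poly_Mapping.lookup m \<notin> B}"
    and B: "downset B" "0 \<in> B"
    and acyc: "\<And>\<alpha>. int (sum \<alpha> UNIV) = j \<Longrightarrow> acyclic_at TYPE('k) B \<alpha> (Suc i)"
  shows "j \<notin> set (D i)"
proof -
  define D' where "D' l = (case l of 0 \<Rightarrow> [0] | Suc l' \<Rightarrow> D l')" for l
  define M where "M l r c = (case l of 0 \<Rightarrow> g $ c | Suc l' \<Rightarrow> A l' $$ (r, c))" for l r c
  have D'[simp]: "D' 0 = [0]" "D' (Suc l) = D l" for l by (simp_all add: D'_def)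
  have M[simp]: "M 0 r c = g $ c" "M (Suc l) r c = A l $$ (r, c)" for l r c by (simp_all add: M_def)
  have gfr: "graded_free_resolution I D g A" using res by (simp add: minimal_graded_free_resolution_def)
  have g: "g \<in> carrier_vec (length (D 0))"
    and all_A: "\<forall>l. A l \<in> carrier_mat (length (D l)) (length (D (Suc l)))"
    and all_hom_g: "\<forall>c<length (D 0). homogeneous (D 0 ! c) (g $ c)"
    and all_hom_A: "\<forall>l. \<forall>r<length (D l). \<forall>c<length (D (Suc l)). homogeneous (D (Suc l) ! c - D l ! r) (A l $$ (r, c))"
    and im: "{g \<bullet> v | v. v \<in> carrier_vec (length (D 0))} = I"
    and ker0: "{v \<in> carrier_vec (length (D 0)). g \<bullet> v = 0} = {A 0 *\<^sub>v w | w. w \<in> carrier_vec (length (D 1))}"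
    and all_ker: "\<forall>l. {v \<in> carrier_vec (length (D (Suc l))). A l *\<^sub>v v = 0\<^sub>v (length (D l))} =
       {A (Suc l) *\<^sub>v w | w. w \<in> carrier_vec (length (D (Suc (Suc l))))}"
    using gfr unfolding graded_free_resolution_def by - (elim conjE, assumption)+
  note A = all_A[rule_format] and hom_g = all_hom_g[rule_format] and hom_A = all_hom_A[rule_format]
    and ker = all_ker[rule_format]
  have Avec: "A l *\<^sub>v vec (length (D (Suc l))) w = vec (length (D l)) (\<lambda>c. \<Sum>c'<length (D (Suc l)). A l $$ (c, c') * w c')" for l w
  proof (rule eq_vecI)
    fix r assume "r < dim_vec (vec (length (D l)) (\<lambda>c. \<Sum>c'<length (D (Suc l)). A l $$ (c, c') * w c'))"
    then have "r < length (D l)" by simp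
    then show "(A l *\<^sub>v vec (length (D (Suc l))) w) $ r = vec (length (D l)) (\<lambda>c. \<Sum>c'<length (D (Suc l)). A l $$ (c, c') * w c') $ r"
      unfolding mult_mat_vec_nth[OF A \<open>r < length (D l)\<close>] by simp
  qed (use A[of l] in simp)
  have "j \<notin> set (D' (Suc i))"
  proof (rule koszul_acyclic_imp_no_generator[of D' M B])
    show "homogeneous (D' (Suc l) ! c - D' l ! r) (M l r c)"
      if "r < length (D' l)" "c < length (D' (Suc l))" for l r c
      using that hom_g hom_A by (cases l) auto
    have "{\<Sum>c<length (D' 1). M 0 0 c * u c | u. True} = {g \<bullet> v | v. v \<in> carrier_vec (length (D 0))}"
    proof (rule subset_antisym; rule subsetI)
      fix p assume "p \<in> {\<Sum>c<length (D' 1). M 0 0 c * u c | u. True}"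
      then obtain u where "p = (\<Sum>c<length (D 0). g $ c * u c)" by auto
      then have "p = g \<bullet> vec (length (D 0)) u" using scalar_prod_vec[OF g] by simp
      then show "p \<in> {g \<bullet> v | v. v \<in> carrier_vec (length (D 0))}" by auto
    next
      fix p assume "p \<in> {g \<bullet> v | v. v \<in> carrier_vec (length (D 0))}"
      then obtain v where "v \<in> carrier_vec (length (D 0))" "p = g \<bullet> v" by auto
      then have "p = (\<Sum>c<length (D 0). g $ c * v $ c)" using scalar_prod_vec[OF g, of "\<lambda>i. v $ i"] by (simp add: vec_nth)
      then show "p \<in> {\<Sum>c<length (D' 1). M 0 0 c * u c | u. True}" by auto
    qed
    then show "{\<Sum>c<length (D' 1). M 0 0 c * u c | u. True} = {p. \<forall>m\<in>Poly_Mapping.keys p. Poly_Mapping.lookup m \<notin> B}"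
      using im I by simp
    show "(\<Sum>c<length (D' (Suc l)). M l r c * (\<Sum>c'<length (D' (Suc (Suc l))). M (Suc l) c c' * w c')) = 0"
      if r: "r < length (D' l)" for l r w
    proof (cases l)
      case 0
      have "A 0 *\<^sub>v vec (length (D 1)) w \<in> {v \<in> carrier_vec (length (D 0)). g \<bullet> v = 0}"
        unfolding ker0 by auto
      then show ?thesis using 0 scalar_prod_vec[OF g] by (simp add: Avec)
    next
      case (Suc k)
      have "A (Suc k) *\<^sub>v vec (length (D (Suc (Suc k)))) w \<in> {v \<in> carrier_vec (length (D (Suc k))). A k *\<^sub>v v = 0\<^sub>v (length (D k))}"
        unfolding ker by auto
      then have "(A k *\<^sub>v (A (Suc k) *\<^sub>v vec (length (D (Suc (Suc k)))) w)) $ r = 0" using r Suc by simp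
      then show ?thesis using r Suc by (simp only: Avec) simp
    qed
    show "\<exists>w. \<forall>c<length (D' (Suc l)). (\<Sum>c'<length (D' (Suc (Suc l))). M (Suc l) c c' * w c') = u c"
      if u: "\<forall>r<length (D' l). (\<Sum>c<length (D' (Suc l)). M l r c * u c) = 0" for l u
    proof -
      have "\<exists>w\<in>carrier_vec (length (D (Suc l))). vec (length (D l)) u = A l *\<^sub>v w"
      proof (cases l)
        case 0
        have "vec (length (D 0)) u \<in> {v \<in> carrier_vec (length (D 0)). g \<bullet> v = 0}"
          using u 0 scalar_prod_vec[OF g] by simp
        then show ?thesis unfolding ker0 using 0 by auto
      next
        case (Suc k)
        have "vec (length (D (Suc k))) u \<in> {v \<in> carrier_vec (length (D (Suc k))). A k *\<^sub>v v = 0\<^sub>v (length (D k))}"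
          using u Suc by (auto simp: Avec)
        then show ?thesis unfolding ker using Suc by auto
      qed
      then obtain w where w: "w \<in> carrier_vec (length (D (Suc l)))" "vec (length (D l)) u = A l *\<^sub>v w" by blast
      then have eq: "vec (length (D l)) u = vec (length (D l)) (\<lambda>c. \<Sum>c'<length (D (Suc l)). A l $$ (c, c') * w $ c')"
        using Avec[of l "\<lambda>i. w $ i"] by (simp add: vec_nth)
      have "u c = (\<Sum>c'<length (D (Suc l)). A l $$ (c, c') * w $ c')" if "c < length (D l)" for c
        using arg_cong[OF eq, of "\<lambda>v. v $ c"] that by simp
      then show ?thesis by (intro exI[of _ "\<lambda>i. w $ i"]) simp
    qed
    show "Poly_Mapping.lookup (M (Suc l) r c) 0 = 0" if "r < length (D' (Suc l))" "c < length (D' (Suc (Suc l)))" for l r c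
      using res that by (simp add: minimal_graded_free_resolution_def irrelevant_ideal_def)
  qed (use B acyc in auto)
  then show ?thesis by simp
qed

theorem corollary4p3:
  fixes E :: "'v::finite set set" and X Y :: "'v set" and s :: nat
    and I :: "('v, 'k::field) mpol set"
  assumes "bipartition E X Y"
    and "I = edge_ideal E"
    and "s \<ge> 1"
  shows "reg (ideal_power I s) \<le> ereal (2 * real s + real (matching_number E) - 1)"
  unfolding reg_def
proof (rule Sup_least)
  let ?B = "\<Union>(light E X s ` cover_parts E X)"
  fix z assume "z \<in> {ereal (of_int (j - int i)) | i j.
     \<exists>D g A. minimal_graded_free_resolution (ideal_power I s) D g A \<and> j \<in> set (D i)}"
  then obtain i j D g A where z: "z = ereal (of_int (j - int i))"
    and res: "minimal_graded_free_resolution (ideal_power I s) D g A" "j \<in> set (D i)" by blast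
  have "j - int i \<le> 2 * int s + int (matching_number E) - 1"
  proof (rule ccontr)
    assume large: "\<not> ?thesis"
    have "j \<notin> set (D i)"
    proof (rule koszul_acyclic_imp_not_in_degrees[OF res(1), of ?B])
      show "ideal_power I s = {p. \<forall>m\<in>Poly_Mapping.keys p. Poly_Mapping.lookup m \<notin> ?B}"
        unfolding assms(2) ideal_power_eq monomial_ideal_def
        by (auto simp: subset_iff power_exponents_eq_light[OF assms(1)])
      show "downset ?B" using downset_light[of E X s] unfolding downset_def by blast
      have "{} \<in> cover_parts E X" "0 \<in> light E X s {}" using assms(3) by (auto simp: cover_parts_def light_def)
      then show "0 \<in> ?B" by blast
      show "acyclic_at TYPE('k) ?B \<alpha> (Suc i)" if "int (sum \<alpha> UNIV) = j" for \<alpha>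
        by (rule acyclic_at_light_Union[OF assms(1)]) (use that large in linarith)
    qed
    then show False using res(2) by contradiction
  qed
  then have "real_of_int (j - int i) \<le> 2 * real s + real (matching_number E) - 1" by linarith
  then show "z \<le> ereal (2 * real s + real (matching_number E) - 1)" unfolding z by (rule ereal_less_eq(3)[THEN iffD2])
qed

end
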